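(* The Poisson structure on the space of chains $(\mathbb A,B_1,\dots,B_j)\in\mathcal A\times GL_N(\mathbb C)^{j}$ compatible with the multiple product $$(\mathbb A,B_1)\circ(B_1\mathbb AB_1^{\mathrm T},B_2)\circ\cdots\circ(B_{j-1}\cdots B_1\mathbb AB_1^{\mathrm T}\cdots B_{j-1}^{\mathrm T},B_j)=(\mathbb A,B_jB_{j-1}\cdots B_2B_1)$$ has the following form: $$\{\overset{1}{\mathbb A},\overset{2}{\mathbb A}\}=r_{12}\overset{1}{\mathbb A}\overset{2}{\mathbb A}-\overset{1}{\mathbb A}\overset{2}{\mathbb A}r_{12}+\overset{1}{\mathbb A}r_{12}^{t_1}\overset{2}{\mathbb A}-\overset{2}{\mathbb A}r_{12}^{t_1}\overset{1}{\mathbb A};\qquad \{\overset{1}{B_1},\overset{2}{\mathbb A}\}=\overset{1}{B_1}Q^{[0]}_{12}\overset{2}{\mathbb A}+\overset{1}{B_1}\overset{2}{\mathbb A}(Q^{[0]}_{12})^{t_2};$$ $B_k$ with $k\ge 2$ Poisson commute with $\mathbb A$; and $$\{\overset{1}{B_k},\overset{2}{B_k}\}=r_{12}\overset{1}{B_k}\overset{2}{B_k}-\overset{1}{B_k}\overset{2}{B_k}r_{12}\ (1\le k\le j),\quad \{\overset{1}{B_{k+1}},\overset{2}{B_k}\}=\overset{1}{B_{k+1}}Q^{[k]}_{12}\overset{2}{B_k}\ (1\le k\le j-1),\quad \{\overset{1}{B_k},\overset{2}{B_l}\}=0\ (|k-l|>1),$$ where each $Q^{[k]}_{12}$, $0\le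 k\le j-1$, is either (i) $0$, or (ii) $-r_{12}^{t_2}$, or (iii) $r_{12}^{t_1}$ (the choices for different $k$ may be different). That is, these formulas define a Poisson structure which is compatible with the multiple product in the sense given in the context.
   Context: $\mathcal A=\mathrm{Mat}_N(\mathbb C)$ is the space of (defining matrices of) bilinear forms on $\mathbb C^N$. $E_{i,j}$ are the $N\times N$ matrix units. For an $N\times N$ matrix $X$ write $\overset{1}{X}=X\otimes I$, $\overset{2}{X}=I\otimes X$. For $T\in \mathrm{Mat}_N\otimes\mathrm{Mat}_N$, $T^{t_1}$ and $T^{t_2}$ denote transposition in the first, respectively second, tensor factor. $\{\overset{1}{X},\overset{2}{Y}\}=\sum_{i,j,k,l}\{x_{i,j},y_{k,l}\}E_{i,j}\otimes E_{k,l}$. The classical $r$-matrix is $r_{12}=\sum_i E_{i,i}\otimes E_{i,i}+2\sum_{i>j}E_{i,j}\otimes E_{j,i}$. Given $Q_{12}\in\{0,-r_{12}^{t_2},r_{12}^{t_1}\}$, the space of pairs $(\mathbb A,B)\in\mathcal A\times GL_N$ is a Poisson space with the brackets $\{\overset{1}{\mathbb A},\overset{2}{\mathbb A}\}=r_{12}\overset{1}{\mathbb A}\overset{2}{\mathbb A}-\overset{1}{\mathbb A}\overset{2}{\mathbb A}r_{12}+\overset{1}{\mathbb A}r_{12}^{t_1}\overset{2}{\mathbb A}-\overset{2}{\mathbb A}r_{12}^{t_1}\overset{1}{\mathbb A}$, $\{\overset{1}{B},\overset{2}{B}\}=r_{12}\overset{1}{B}\overset{2}{B}-\overset{1}{B}\overset{2}{B}r_{12}$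 and $\{\overset{1}{B},\overset{2}{\mathbb A}\}=\overset{1}{B}Q_{12}\overset{2}{\mathbb A}+\overset{1}{B}\overset{2}{\mathbb A}Q_{12}^{t_2}$; call this the pair of type $Q$. Compatibility of a Poisson structure on chains with the multiple product means: the map $(\mathbb A,B_1,\dots,B_j)\mapsto(\mathbb A,B_j\cdots B_1)$ is Poisson to the pairs of type $Q^{[0]}$, and for each $k=1,\dots,j$ the map $(\mathbb A,B_1,\dots,B_j)\mapsto(B_{k-1}\cdots B_1\mathbb AB_1^{\mathrm T}\cdots B_{k-1}^{\mathrm T},B_k)$ is Poisson to the pairs of type $Q^{[k-1]}$ (for $j=2$ these are the three maps to $(\mathbb A,B_1)$, $(\mathbb A,B_2B_1)$ and $(B_1\mathbb AB_1^{\mathrm T},B_2)$). *)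

theory Defs
  imports "HOL-Analysis.Analysis" "HOL-Library.FuncSet"
begin

text \<open>
  The size \<open>N\<close> is the cardinality of a finite linearly ordered index type \<open>'n\<close>; the order is
  needed for the \<open>r\<close>-matrix.  \<open>Mat\<^sub>N \<otimes> Mat\<^sub>N\<close> is identified with the matrices indexed by
  \<open>'n \<times> 'n\<close>: the coefficient of \<open>E\<^sub>i\<^sub>j \<otimes> E\<^sub>k\<^sub>l\<close> stands in row \<open>(i, k)\<close> and column \<open>(j, l)\<close>.
\<close>

type_synonym 'n cmatrix = "complex ^ 'n ^ 'n"
type_synonym 'n tensor = "complex ^ ('n \<times> 'n) ^ ('n \<times> 'n)"
type_synonym 'p bracket = "('p \<Rightarrow> complex) \<Rightarrow> ('p \<Rightarrow> complex) \<Rightarrow> 'p \<Rightarrow> complex"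

definition matrix_unit :: "'n::finite \<Rightarrow> 'n \<Rightarrow> 'n cmatrix" where
  "matrix_unit i j = (\<chi> a b. if a = i \<and> b = j then 1 else 0)"

definition kron :: "'n::finite cmatrix \<Rightarrow> 'n cmatrix \<Rightarrow> 'n tensor" where
  "kron X Y = (\<chi> p q. X $ fst p $ fst q * Y $ snd p $ snd q)"

abbreviation leg1 :: "'n::finite cmatrix \<Rightarrow> 'n tensor" where
  "leg1 X \<equiv> kron X (mat 1)"

abbreviation leg2 :: "'n::finite cmatrix \<Rightarrow> 'n tensor" where
  "leg2 X \<equiv> kron (mat 1) X"

definition transp1 :: "'n::finite tensor \<Rightarrow> 'n tensor" where
  "transp1 T = (\<chi> p q. T $ (fst q, snd p) $ (fst p, snd q))"

definition transp2 :: "'n::finite tensor \<Rightarrow> 'n tensor" where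
  "transp2 T = (\<chi> p q. T $ (fst p, snd q) $ (fst q, snd p))"

definition r_matrix :: "'n::{finite,linorder} tensor" where
  "r_matrix = (\<Sum>i\<in>UNIV. kron (matrix_unit i i) (matrix_unit i i))
     + 2 *\<^sub>R (\<Sum>(i, j)\<in>{(i, j). i > j}. kron (matrix_unit i j) (matrix_unit j i))"

definition Q_types :: "'n::{finite,linorder} tensor set" where
  "Q_types = {0, - transp2 r_matrix, transp1 r_matrix}"


text \<open>
  A function on a space \<open>S\<close> is represented by the total function which is \<open>undefined\<close> outside
  \<open>S\<close>, so that functions agreeing on \<open>S\<close> are equal.  The following is the algebra of functions on
  \<open>S\<close> generated by the restrictions of the functions in \<open>G\<close>.
\<close>

inductive_set function_algebra :: "'p set \<Rightarrow> ('p \<Rightarrow> complex) set \<Rightarrow> ('p \<Rightarrow> complex) set"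
  for S :: "'p set" and G :: "('p \<Rightarrow> complex) set" where
  const: "(\<lambda>x\<in>S. c) \<in> function_algebra S G"
| gen: "g \<in> G \<Longrightarrow> restrict g S \<in> function_algebra S G"
| add: "f \<in> function_algebra S G \<Longrightarrow> g \<in> function_algebra S G
    \<Longrightarrow> (\<lambda>x\<in>S. f x + g x) \<in> function_algebra S G"
| mult: "f \<in> function_algebra S G \<Longrightarrow> g \<in> function_algebra S G
    \<Longrightarrow> (\<lambda>x\<in>S. f x * g x) \<in> function_algebra S G"

definition poisson_structure :: "'p set \<Rightarrow> ('p \<Rightarrow> complex) set \<Rightarrow> 'p bracket \<Rightarrow> bool" where
  "poisson_structure S F br \<longleftrightarrow>
     (\<forall>f\<in>F. \<forall>g\<in>F. br f g \<in> F) \<and>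
     (\<forall>f\<in>F. \<forall>g\<in>F. \<forall>x\<in>S. br f g x = - br g f x) \<and>
     (\<forall>c. \<forall>f\<in>F. \<forall>g\<in>F. \<forall>h\<in>F. \<forall>x\<in>S.
        br (\<lambda>y\<in>S. c * f y + g y) h x = c * br f h x + br g h x) \<and>
     (\<forall>f\<in>F. \<forall>g\<in>F. \<forall>h\<in>F. \<forall>x\<in>S.
        br (\<lambda>y\<in>S. f y * g y) h x = f x * br g h x + br f h x * g x) \<and>
     (\<forall>f\<in>F. \<forall>g\<in>F. \<forall>h\<in>F. \<forall>x\<in>S.
        br f (br g h) x + br g (br h f) x + br h (br f g) x = 0)"

definition poisson_map ::
  "'p set \<Rightarrow> ('p \<Rightarrow> complex) set \<Rightarrow> 'p bracket \<Rightarrow>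
   'q set \<Rightarrow> ('q \<Rightarrow> complex) set \<Rightarrow> 'q bracket \<Rightarrow> ('p \<Rightarrow> 'q) \<Rightarrow> bool" where
  "poisson_map S F br S' F' br' \<phi> \<longleftrightarrow>
     \<phi> \<in> S \<rightarrow> S' \<and>
     (\<forall>f\<in>F'. (\<lambda>x\<in>S. f (\<phi> x)) \<in> F) \<and>
     (\<forall>f\<in>F'. \<forall>g\<in>F'. \<forall>x\<in>S. br (\<lambda>y\<in>S. f (\<phi> y)) (\<lambda>y\<in>S. g (\<phi> y)) x = br' f g (\<phi> x))"

text \<open>\<open>{X\<^sup>1, Y\<^sup>2} = \<Sum> {x\<^sub>i\<^sub>j, y\<^sub>k\<^sub>l} E\<^sub>i\<^sub>j \<otimes> E\<^sub>k\<^sub>l\<close> for matrix-valued functions \<open>X\<close>, \<open>Y\<close>, evaluated at a point.\<close>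

definition tensor_bracket ::
  "'p set \<Rightarrow> 'p bracket \<Rightarrow> ('p \<Rightarrow> 'n::finite cmatrix) \<Rightarrow> ('p \<Rightarrow> 'n cmatrix) \<Rightarrow> 'p \<Rightarrow> 'n tensor" where
  "tensor_bracket S br X Y x =
     (\<chi> p q. br (\<lambda>y\<in>S. X y $ fst p $ fst q) (\<lambda>y\<in>S. Y y $ snd p $ snd q) x)"

definition AA_rhs :: "'n::{finite,linorder} cmatrix \<Rightarrow> 'n tensor" where
  "AA_rhs A = r_matrix ** leg1 A ** leg2 A - leg1 A ** leg2 A ** r_matrix
     + leg1 A ** transp1 r_matrix ** leg2 A - leg2 A ** transp1 r_matrix ** leg1 A"

definition BB_rhs :: "'n::{finite,linorder} cmatrix \<Rightarrow> 'n tensor" where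
  "BB_rhs B = r_matrix ** leg1 B ** leg2 B - leg1 B ** leg2 B ** r_matrix"

definition BA_rhs :: "'n::finite tensor \<Rightarrow> 'n cmatrix \<Rightarrow> 'n cmatrix \<Rightarrow> 'n tensor" where
  "BA_rhs Q B A = leg1 B ** Q ** leg2 A + leg1 B ** leg2 A ** transp2 Q"


definition GL :: "'n::finite cmatrix set" where
  "GL = {B. invertible B}"

definition pairs :: "('n::finite cmatrix \<times> 'n cmatrix) set" where
  "pairs = UNIV \<times> GL"

text \<open>Regular functions: polynomials in the entries of \<open>A\<close> and \<open>B\<close> and in \<open>1 / det B\<close>.\<close>

definition pair_functions :: "('n::finite cmatrix \<times> 'n cmatrix \<Rightarrow> complex) set" where
  "pair_functions = function_algebra pairs
     ({\<lambda>x. fst x $ a $ b | a b. True} \<union> {\<lambda>x. snd x $ a $ b | a b. True}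
      \<union> {\<lambda>x. inverse (det (snd x))})"

definition pair_of_type ::
  "'n::{finite,linorder} tensor \<Rightarrow> ('n cmatrix \<times> 'n cmatrix) bracket \<Rightarrow> bool" where
  "pair_of_type Q br \<longleftrightarrow>
     poisson_structure pairs pair_functions br \<and>
     (\<forall>x\<in>pairs.
        tensor_bracket pairs br fst fst x = AA_rhs (fst x) \<and>
        tensor_bracket pairs br snd snd x = BB_rhs (snd x) \<and>
        tensor_bracket pairs br snd fst x = BA_rhs Q (snd x) (fst x))"


text \<open>A chain \<open>(A, B\<^sub>1, \<dots>, B\<^sub>j)\<close> is a pair of \<open>A\<close> and a family \<open>B\<close> indexed by \<open>{1..j}\<close>.\<close>

type_synonym 'n chain = "'n cmatrix \<times> (nat \<Rightarrow> 'n cmatrix)"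

definition chain_space :: "nat \<Rightarrow> 'n::finite chain set" where
  "chain_space j = UNIV \<times> ({1..j} \<rightarrow>\<^sub>E GL)"

abbreviation chain_B :: "nat \<Rightarrow> 'n::finite chain \<Rightarrow> 'n cmatrix" where
  "chain_B k x \<equiv> snd x k"

definition chain_functions :: "nat \<Rightarrow> ('n::finite chain \<Rightarrow> complex) set" where
  "chain_functions j = function_algebra (chain_space j)
     ({\<lambda>x. fst x $ a $ b | a b. True}
      \<union> {\<lambda>x. chain_B k x $ a $ b | k a b. k \<in> {1..j}}
      \<union> {\<lambda>x. inverse (det (chain_B k x)) | k. k \<in> {1..j}})"

definition chain_formulas ::
  "nat \<Rightarrow> (nat \<Rightarrow> 'n::{finite,linorder} tensor) \<Rightarrow> 'n chain bracket \<Rightarrow> bool" where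
  "chain_formulas j Q br \<longleftrightarrow>
     (\<forall>x\<in>chain_space j.
        tensor_bracket (chain_space j) br fst fst x = AA_rhs (fst x) \<and>
        tensor_bracket (chain_space j) br (chain_B 1) fst x = BA_rhs (Q 0) (chain_B 1 x) (fst x) \<and>
        (\<forall>k\<in>{2..j}. tensor_bracket (chain_space j) br (chain_B k) fst x = 0) \<and>
        (\<forall>k\<in>{1..j}. tensor_bracket (chain_space j) br (chain_B k) (chain_B k) x = BB_rhs (chain_B k x)) \<and>
        (\<forall>k\<in>{1..<j}. tensor_bracket (chain_space j) br (chain_B (k + 1)) (chain_B k) x
            = leg1 (chain_B (k + 1) x) ** Q k ** leg2 (chain_B k x)) \<and>
        (\<forall>k\<in>{1..j}. \<forall>l\<in>{1..j}. \<bar>int k - int l\<bar> > 1 \<longrightarrow>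
            tensor_bracket (chain_space j) br (chain_B k) (chain_B l) x = 0))"

text \<open>\<open>B\<^sub>k \<cdots> B\<^sub>1\<close> and \<open>B\<^sub>k \<cdots> B\<^sub>1 A B\<^sub>1\<^sup>T \<cdots> B\<^sub>k\<^sup>T\<close>.\<close>

fun iterated_product :: "nat \<Rightarrow> 'n::finite chain \<Rightarrow> 'n cmatrix" where
  "iterated_product 0 x = mat 1"
| "iterated_product (Suc k) x = chain_B (Suc k) x ** iterated_product k x"

fun transformed_form :: "nat \<Rightarrow> 'n::finite chain \<Rightarrow> 'n cmatrix" where
  "transformed_form 0 x = fst x"
| "transformed_form (Suc k) x =
     chain_B (Suc k) x ** transformed_form k x ** transpose (chain_B (Suc k) x)"

text \<open>
  The brackets of the coordinate functions determine a Poisson structure on the pairs, so the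
  structure of type \<open>Q\<close> quantified existentially here is unique.
\<close>

definition poisson_to_pairs ::
  "nat \<Rightarrow> 'n::{finite,linorder} chain bracket \<Rightarrow> 'n tensor \<Rightarrow> ('n chain \<Rightarrow> 'n cmatrix \<times> 'n cmatrix) \<Rightarrow> bool"
  where
  "poisson_to_pairs j br Q \<phi> \<longleftrightarrow>
     (\<exists>pbr. pair_of_type Q pbr \<and>
        poisson_map (chain_space j) (chain_functions j) br pairs pair_functions pbr \<phi>)"

definition compatible_with_multiple_product ::
  "nat \<Rightarrow> (nat \<Rightarrow> 'n::{finite,linorder} tensor) \<Rightarrow> 'n chain bracket \<Rightarrow> bool" where
  "compatible_with_multiple_product j Q br \<longleftrightarrow>
     poisson_to_pairs j br (Q 0) (\<lambda>x. (fst x, iterated_product j x)) \<and>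
     (\<forall>k\<in>{1..j}. poisson_to_pairs j br (Q (k - 1)) (\<lambda>x. (transformed_form (k - 1) x, chain_B k x)))"

end

theory Submission
  imports Defs
begin

text \<open>
  Let \<open>s i j\<close> be the sign of \<open>i - j\<close>.  Written out in entries, the bracket of two coordinates \<open>x\<close> and
  \<open>y\<close> is the sum, over the index slots \<open>a\<close> of \<open>x\<close> and \<open>b\<close> of \<open>y\<close> with indices \<open>i\<close> and \<open>j\<close>, of
  \<open>c\<^sub>a\<^sub>b i j\<close> times the product of \<open>x\<close> and \<open>y\<close> with these two indices exchanged, where \<open>c\<^sub>a\<^sub>b i j\<close> is either
  \<open>0\<close> or \<open>s i j + s (level a) (level b)\<close>.  The three types of \<open>Q\<close> say whether the column slot of a
  matrix interacts with the slots of its predecessor, and if so whether it lies below or above them.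
  The Jacobi identity for coordinates splits into terms with disjoint slots, which cancel, and one
  classical Yang-Baxter equation for each triple of slots; its inhomogeneous part occurs only if the
  three slots coincide, and then the contributions of the row and of the column slot cancel.  Under
  the product maps the contracted slots contribute terms which are antisymmetric in the summation
  indices.  The Jacobi identity, the Poisson property of maps and uniqueness need to be checked on
  coordinates only, since both sides are derivations in every argument.
\<close>

text \<open>The constants come from splitting \<open>r_matrix\<close> into the permutation operator
  (weight 1) and its skew part (weight \<open>sg i k\<close>). The permutation commutes with X
  \<otimes> X and drops out of r XX - XX r, but the partial transposes in the bracket of A and in Q
  keep it, as +1 or -1. Reading this +-1 as the sign of a difference of levels turns all formulas
  into one: the slots at a node are linearly ordered, and the Yang-Baxter equation reduces to a
  single identity for signs, used once for the indices and once for the levels.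

  The analytic obstacle is that members of the function algebra are plain functions without a chosen
  polynomial expression, so a bracket prescribed on coordinates cannot be extended by recursion on
  expressions. It is therefore defined as a bivector field, with partial derivatives taken by
  complex differentiation. The price is a proof that these derivatives exist and stay in the
  algebra, where 1/det and the openness of \<open>GL\<close> enter. The pairs need no second
  construction, being chains of length one.\<close>

text \<open>\<open>restrict_apply\<close> would unfold \<open>\<lambda>x\<in>S. f x\<close> even where it is not applied to an argument.\<close>

declare restrict_apply [simp del] restrict_apply' [simp]

section \<open>Function algebras and derivations\<close>

lemma restrict_in_function_algebra:
  "f \<in> function_algebra S G \<Longrightarrow> restrict f S = f"
  by (induction rule: function_algebra.induct) (auto simp: restrict_def)

lemma function_algebra_const [simp, intro]: "(\<lambda>x\<in>S. c) \<in> function_algebra S G"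
  by (rule function_algebra.const)

lemma function_algebra_add:
  assumes "restrict f S \<in> function_algebra S G" "restrict g S \<in> function_algebra S G"
  shows "(\<lambda>x\<in>S. f x + g x) \<in> function_algebra S G"
proof -
  have "(\<lambda>x\<in>S. restrict f S x + restrict g S x) = (\<lambda>x\<in>S. f x + g x)"
    by (auto simp: restrict_def)
  then show ?thesis using function_algebra.add[OF assms] by simp
qed

lemma function_algebra_mult:
  assumes "restrict f S \<in> function_algebra S G" "restrict g S \<in> function_algebra S G"
  shows "(\<lambda>x\<in>S. f x * g x) \<in> function_algebra S G"
proof -
  have "(\<lambda>x\<in>S. restrict f S x * restrict g S x) = (\<lambda>x\<in>S. f x * g x)"
    by (auto simp: restrict_def)
  then show ?thesis using function_algebra.mult[OF assms] by simp
qed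

lemma function_algebra_uminus:
  assumes "restrict f S \<in> function_algebra S G"
  shows "(\<lambda>x\<in>S. - f x) \<in> function_algebra S G"
  using function_algebra_mult[OF function_algebra_const[of "-1"] assms] by simp

lemma function_algebra_sum:
  assumes "finite A" "\<And>a. a \<in> A \<Longrightarrow> restrict (f a) S \<in> function_algebra S G"
  shows "(\<lambda>x\<in>S. \<Sum>a\<in>A. f a x) \<in> function_algebra S G"
  using assms by (induction) (auto intro!: function_algebra_add)

lemma function_algebra_prod:
  assumes "finite A" "\<And>a. a \<in> A \<Longrightarrow> restrict (f a) S \<in> function_algebra S G"
  shows "(\<lambda>x\<in>S. \<Prod>a\<in>A. f a x) \<in> function_algebra S G"
  using assms by (induction) (auto intro!: function_algebra_mult)

lemma function_algebra_mono:
  assumes "G \<subseteq> H"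
  shows "function_algebra S G \<subseteq> function_algebra S H"
proof
  fix f assume "f \<in> function_algebra S G"
  then show "f \<in> function_algebra S H"
    by induction (use assms in \<open>auto intro: function_algebra.intros\<close>)
qed

lemma function_algebra_pullback:
  assumes "\<phi> \<in> S \<rightarrow> S'"
    and "\<And>g. g \<in> G' \<Longrightarrow> (\<lambda>x\<in>S. g (\<phi> x)) \<in> function_algebra S G"
    and "f \<in> function_algebra S' G'"
  shows "(\<lambda>x\<in>S. f (\<phi> x)) \<in> function_algebra S G"
proof -
  have \<phi>: "\<And>x. x \<in> S \<Longrightarrow> \<phi> x \<in> S'" using assms(1) by auto
  show ?thesis using assms(3)
  proof induction
    case (const c)
    have "(\<lambda>x\<in>S. (\<lambda>x\<in>S'. c) (\<phi> x)) = (\<lambda>x\<in>S. c)"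
      by (intro restrict_ext) (simp add: \<phi>)
    then show ?case by (simp only: function_algebra_const)
  next
    case (gen g)
    have "(\<lambda>x\<in>S. restrict g S' (\<phi> x)) = (\<lambda>x\<in>S. g (\<phi> x))"
      by (intro restrict_ext) (simp add: \<phi>)
    then show ?case using assms(2)[OF gen] by simp
  next
    case (add f g)
    have "(\<lambda>x\<in>S. (\<lambda>x\<in>S'. f x + g x) (\<phi> x)) = (\<lambda>x\<in>S. f (\<phi> x) + g (\<phi> x))"
      by (intro restrict_ext) (simp add: \<phi>)
    then show ?case using function_algebra_add[OF add.IH] by simp
  next
    case (mult f g)
    have "(\<lambda>x\<in>S. (\<lambda>x\<in>S'. f x * g x) (\<phi> x)) = (\<lambda>x\<in>S. f (\<phi> x) * g (\<phi> x))"
      by (intro restrict_ext) (simp add: \<phi>)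
    then show ?case using function_algebra_mult[OF mult.IH] by simp
  qed
qed

lemma function_algebra_det:
  fixes M :: "'p \<Rightarrow> complex ^ 'n ^ 'n"
  assumes "\<And>a b. (\<lambda>x\<in>S. M x $ a $ b) \<in> function_algebra S G"
  shows "(\<lambda>x\<in>S. det (M x)) \<in> function_algebra S G"
  unfolding det_def
  by (intro function_algebra_sum function_algebra_mult function_algebra_prod assms) auto

section \<open>Derivations at a point and their extension from generators\<close>

definition derivation_at ::
  "'p set \<Rightarrow> ('p \<Rightarrow> complex) set \<Rightarrow> 'p \<Rightarrow> (('p \<Rightarrow> complex) \<Rightarrow> complex) \<Rightarrow> bool" where
  "derivation_at S F x \<delta> \<longleftrightarrow>
     (\<forall>c. \<forall>f\<in>F. \<forall>g\<in>F. \<delta> (\<lambda>y\<in>S. c * f y + g y) = c * \<delta> f + \<delta> g) \<and>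
     (\<forall>f\<in>F. \<forall>g\<in>F. \<delta> (\<lambda>y\<in>S. f y * g y) = f x * \<delta> g + \<delta> f * g x)"

lemma derivation_at_zero: "derivation_at S F x (\<lambda>f. 0)"
  by (simp add: derivation_at_def)

lemma derivation_at_const:
  assumes "derivation_at S (function_algebra S G) x \<delta>" "x \<in> S"
  shows "\<delta> (\<lambda>y\<in>S. c) = 0"
proof -
  let ?F = "function_algebra S G"
  have lin: "\<And>c f g. f \<in> ?F \<Longrightarrow> g \<in> ?F \<Longrightarrow> \<delta> (\<lambda>y\<in>S. c * f y + g y) = c * \<delta> f + \<delta> g"
    and leib: "\<And>f g. f \<in> ?F \<Longrightarrow> g \<in> ?F \<Longrightarrow> \<delta> (\<lambda>y\<in>S. f y * g y) = f x * \<delta> g + \<delta> f * g x"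
    using assms(1) unfolding derivation_at_def by blast+
  have *: "(\<lambda>y\<in>S. (\<lambda>y\<in>S. a) y * (\<lambda>y\<in>S. b) y) = (\<lambda>y\<in>S. a * b)" for a b :: complex
    by (auto simp: restrict_def)
  \<comment> \<open>Leibniz for 1 * 1 = 1 reads \<delta> 1 = 2 \<delta> 1, and for 0 * 0 = 0 both
    terms have a factor 0.\<close>
  have one: "\<delta> (\<lambda>y\<in>S. 1) = 0"
    using leib[of "\<lambda>y\<in>S. 1" "\<lambda>y\<in>S. 1"] assms(2) unfolding * by simp
  have zero: "\<delta> (\<lambda>y\<in>S. 0) = 0"
    using leib[of "\<lambda>y\<in>S. 0" "\<lambda>y\<in>S. 0"] assms(2) unfolding * by simp
  have "(\<lambda>y\<in>S. c * (\<lambda>y\<in>S. 1) y + (\<lambda>y\<in>S. 0) y) = (\<lambda>y\<in>S. c)"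
    by (auto simp: restrict_def)
  then show ?thesis
    using lin[of "\<lambda>y\<in>S. 1" "\<lambda>y\<in>S. 0" c] one zero by simp
qed

lemma derivation_at_add:
  assumes "derivation_at S F x \<delta>" "f \<in> F" "g \<in> F"
  shows "\<delta> (\<lambda>y\<in>S. f y + g y) = \<delta> f + \<delta> g"
proof -
  have "\<delta> (\<lambda>y\<in>S. 1 * f y + g y) = 1 * \<delta> f + \<delta> g"
    using assms unfolding derivation_at_def by blast
  then show ?thesis by simp
qed

lemma derivation_at_cmult:
  assumes "derivation_at S (function_algebra S G) x \<delta>" "x \<in> S" "restrict f S \<in> function_algebra S G"
  shows "\<delta> (\<lambda>y\<in>S. c * f y) = c * \<delta> (restrict f S)"
proof -
  have "\<delta> (\<lambda>y\<in>S. c * restrict f S y + (\<lambda>y\<in>S. 0) y) = c * \<delta> (restrict f S) + \<delta> (\<lambda>y\<in>S. 0)"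
    using assms unfolding derivation_at_def by blast
  moreover have "(\<lambda>y\<in>S. c * restrict f S y + (\<lambda>y\<in>S. 0) y) = (\<lambda>y\<in>S. c * f y)"
    by (intro restrict_ext) simp
  ultimately show ?thesis using derivation_at_const[OF assms(1,2), of 0] by simp
qed

lemma derivation_at_plus:
  assumes "derivation_at S F x \<delta>" "restrict f S \<in> F" "restrict g S \<in> F"
  shows "\<delta> (\<lambda>y\<in>S. f y + g y) = \<delta> (restrict f S) + \<delta> (restrict g S)"
proof -
  have "(\<lambda>y\<in>S. restrict f S y + restrict g S y) = (\<lambda>y\<in>S. f y + g y)"
    by (intro restrict_ext) simp
  then show ?thesis using derivation_at_add[OF assms] by simp
qed

lemma derivation_at_times:
  assumes "derivation_at S F x \<delta>" "x \<in> S" "restrict f S \<in> F" "restrict g S \<in> F"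
  shows "\<delta> (\<lambda>y\<in>S. f y * g y) = f x * \<delta> (restrict g S) + \<delta> (restrict f S) * g x"
proof -
  have "(\<lambda>y\<in>S. restrict f S y * restrict g S y) = (\<lambda>y\<in>S. f y * g y)"
    by (intro restrict_ext) simp
  moreover have "\<delta> (\<lambda>y\<in>S. restrict f S y * restrict g S y)
      = restrict f S x * \<delta> (restrict g S) + \<delta> (restrict f S) * restrict g S x"
    using assms unfolding derivation_at_def by blast
  ultimately show ?thesis using assms(2) by simp
qed

lemma derivation_at_sum:
  assumes "derivation_at S (function_algebra S G) x \<delta>" "x \<in> S" "finite A"
    and "\<And>a. a \<in> A \<Longrightarrow> restrict (f a) S \<in> function_algebra S G"
  shows "\<delta> (\<lambda>y\<in>S. \<Sum>a\<in>A. f a y) = (\<Sum>a\<in>A. \<delta> (restrict (f a) S))"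
  using assms(3,4)
proof (induction A)
  case empty
  then show ?case using derivation_at_const[OF assms(1,2), of 0] by simp
next
  case (insert a A)
  have "\<delta> (\<lambda>y\<in>S. f a y + (\<Sum>a\<in>A. f a y)) = \<delta> (restrict (f a) S) + \<delta> (\<lambda>y\<in>S. \<Sum>a\<in>A. f a y)"
    using insert by (intro derivation_at_plus[OF assms(1)] function_algebra_sum) auto
  then show ?case using insert by simp
qed

text \<open>
  A derivation is determined by its values on \<open>E\<close>, because \<open>\<delta> (1 / h)\<close> is determined by \<open>\<delta> h\<close>.
\<close>

lemma derivation_at_eqI:
  assumes x: "x \<in> S"
    and \<delta>: "derivation_at S (function_algebra S (E \<union> I)) x \<delta>"
    and \<delta>': "derivation_at S (function_algebra S (E \<union> I)) x \<delta>'"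
    and eq: "\<And>e. e \<in> E \<Longrightarrow> \<delta> (restrict e S) = \<delta>' (restrict e S)"
    and inv: "\<And>g. g \<in> I \<Longrightarrow> \<exists>h. restrict h S \<in> function_algebra S E \<and> (\<forall>y\<in>S. g y * h y = 1)"
    and f: "f \<in> function_algebra S (E \<union> I)"
  shows "\<delta> f = \<delta>' f"
proof -
  let ?F = "function_algebra S (E \<union> I)"
  have leib: "\<And>f g. f \<in> ?F \<Longrightarrow> g \<in> ?F \<Longrightarrow> \<delta> (\<lambda>y\<in>S. f y * g y) = f x * \<delta> g + \<delta> f * g x"
    using \<delta> unfolding derivation_at_def by blast
  have leib': "\<And>f g. f \<in> ?F \<Longrightarrow> g \<in> ?F \<Longrightarrow> \<delta>' (\<lambda>y\<in>S. f y * g y) = f x * \<delta>' g + \<delta>' f * g x"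
    using \<delta>' unfolding derivation_at_def by blast
  have sub: "f \<in> ?F" if "f \<in> function_algebra S E" for f
    using function_algebra_mono[of E "E \<union> I" S] that by auto
  \<comment> \<open>A separate pass over the subalgebra generated by \<open>E\<close>: for a
    generator \<open>g\<close> in \<open>I\<close> the argument needs agreement at its inverse
    \<open>h\<close>, which no induction hypothesis on the full algebra provides.\<close>
  have poly: "\<delta> f = \<delta>' f" if "f \<in> function_algebra S E" for f
    using that
  proof induction
    case (const c)
    then show ?case using derivation_at_const[OF \<delta> x] derivation_at_const[OF \<delta>' x] by simp
  next
    case (gen g)
    then show ?case by (rule eq)
  next
    case (add f g)
    then show ?case
      using derivation_at_add[OF \<delta>] derivation_at_add[OF \<delta>'] sub by simp
  next
    case (mult f g)
    then show ?case using leib leib' sub by simp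
  qed
  show ?thesis using f
  proof induction
    case (const c)
    then show ?case using derivation_at_const[OF \<delta> x] derivation_at_const[OF \<delta>' x] by simp
  next
    case (gen g)
    show ?case
    proof (cases "g \<in> E")
      case True
      then show ?thesis by (rule eq)
    next
      case False
      then obtain h where h: "restrict h S \<in> function_algebra S E" "\<forall>y\<in>S. g y * h y = 1"
        using gen inv by blast
      have g: "restrict g S \<in> ?F" using gen by (rule function_algebra.gen)
      have one: "(\<lambda>y\<in>S. restrict g S y * restrict h S y) = (\<lambda>y\<in>S. 1)"
        using h(2) by (intro restrict_ext) auto
      have "g x * \<delta> (restrict h S) + \<delta> (restrict g S) * h x = 0"
        using leib[OF g sub[OF h(1)]] derivation_at_const[OF \<delta> x] x unfolding one by simp
      moreover have "g x * \<delta>' (restrict h S) + \<delta>' (restrict g S) * h x = 0"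
        using leib'[OF g sub[OF h(1)]] derivation_at_const[OF \<delta>' x] x unfolding one by simp
      ultimately have "\<delta> (restrict g S) * h x = \<delta>' (restrict g S) * h x"
        using poly[OF h(1)] by (simp add: add_eq_0_iff)
      moreover have "h x \<noteq> 0" using h(2) x by force
      ultimately show ?thesis by simp
    qed
  next
    case (add f g)
    then show ?case using derivation_at_add[OF \<delta>] derivation_at_add[OF \<delta>'] by simp
  next
    case (mult f g)
    then show ?case using leib leib' by simp
  qed
qed

lemma poisson_structure_derivation_left:
  assumes "poisson_structure S F br" "h \<in> F" "x \<in> S"
  shows "derivation_at S F x (\<lambda>f. br f h x)"
  using assms unfolding poisson_structure_def derivation_at_def by blast

lemma poisson_structure_skew:
  assumes "poisson_structure S F br" "f \<in> F" "h \<in> F" "x \<in> S"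
  shows "br f h x = - br h f x"
  using assms unfolding poisson_structure_def by blast

lemma poisson_structure_closed:
  assumes "poisson_structure S F br" "f \<in> F" "h \<in> F"
  shows "br f h \<in> F"
  using assms unfolding poisson_structure_def by blast

text \<open>The Jacobiator is a derivation in each argument, so it vanishes if it vanishes on \<open>E\<close>.\<close>

lemma poisson_structureI:
  fixes S :: "'p set" and E I :: "('p \<Rightarrow> complex) set"
  defines "F \<equiv> function_algebra S (E \<union> I)"
  assumes closed: "\<And>f g. f \<in> F \<Longrightarrow> g \<in> F \<Longrightarrow> br f g \<in> F"
    and skew: "\<And>f g x. f \<in> F \<Longrightarrow> g \<in> F \<Longrightarrow> x \<in> S \<Longrightarrow> br f g x = - br g f x"
    and der: "\<And>h x. h \<in> F \<Longrightarrow> x \<in> S \<Longrightarrow> derivation_at S F x (\<lambda>f. br f h x)"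
    and inv: "\<And>g. g \<in> I \<Longrightarrow> \<exists>h. restrict h S \<in> function_algebra S E \<and> (\<forall>y\<in>S. g y * h y = 1)"
    and jacobi: "\<And>f g h x. f \<in> E \<Longrightarrow> g \<in> E \<Longrightarrow> h \<in> E \<Longrightarrow> x \<in> S \<Longrightarrow>
      br (restrict f S) (br (restrict g S) (restrict h S)) x
      + br (restrict g S) (br (restrict h S) (restrict f S)) x
      + br (restrict h S) (br (restrict f S) (restrict g S)) x = 0"
  shows "poisson_structure S F br"
proof -
  have lin: "br (\<lambda>y\<in>S. c * f y + g y) h x = c * br f h x + br g h x"
    and leib: "br (\<lambda>y\<in>S. f y * g y) h x = f x * br g h x + br f h x * g x"
    if "f \<in> F" "g \<in> F" "h \<in> F" "x \<in> S" for f g h x c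
    using der[OF that(3,4)] that(1,2) unfolding derivation_at_def by blast+
  have F_lin: "(\<lambda>y\<in>S. c * f y + g y) \<in> F" if "f \<in> F" "g \<in> F" for c f g
    using that unfolding F_def
    by (auto intro!: function_algebra_add function_algebra_mult simp: restrict_in_function_algebra)
  have F_mult: "(\<lambda>y\<in>S. f y * g y) \<in> F" if "f \<in> F" "g \<in> F" for f g
    using that unfolding F_def by (rule function_algebra.mult)
  have linR: "br h (\<lambda>y\<in>S. c * f y + g y) x = c * br h f x + br h g x"
    and leibR: "br h (\<lambda>y\<in>S. f y * g y) x = f x * br h g x + br h f x * g x"
    if "f \<in> F" "g \<in> F" "h \<in> F" "x \<in> S" for f g h x c
    unfolding skew[OF that(3) F_lin[OF that(1,2)] that(4)] skew[OF that(3) F_mult[OF that(1,2)] that(4)]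
      lin[OF that] leib[OF that] skew[OF that(3,1,4)] skew[OF that(3,2,4)]
    by (simp_all add: algebra_simps)
  have ext: "f = restrict k S" if "f \<in> F" "\<And>y. y \<in> S \<Longrightarrow> f y = k y" for f k
    using restrict_in_function_algebra[of f S] restrict_ext[of S f k] that unfolding F_def by metis
  have F_lin1: "(\<lambda>y\<in>S. f y + g y) \<in> F" if "f \<in> F" "g \<in> F" for f g
    using F_lin[OF that, of 1] by simp
  have add: "br h (\<lambda>y\<in>S. f y + g y) x = br h f x + br h g x"
    if "f \<in> F" "g \<in> F" "h \<in> F" "x \<in> S" for f g h x
    using linR[OF that, of 1] by simp
  define J where "J f g h x = br f (br g h) x + br g (br h f) x + br h (br f g) x" for f g h x
  have J_der: "derivation_at S F x (\<lambda>f. J f g h x)" if gh: "g \<in> F" "h \<in> F" and x: "x \<in> S" for g h x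
    unfolding derivation_at_def
  proof (intro conjI allI ballI)
    fix c f1 f2 assume f: "f1 \<in> F" "f2 \<in> F"
    have 1: "br h (\<lambda>y\<in>S. c * f1 y + f2 y) = (\<lambda>y\<in>S. c * br h f1 y + br h f2 y)"
      using f gh by (intro ext closed F_lin linR)
    have 2: "br (\<lambda>y\<in>S. c * f1 y + f2 y) g = (\<lambda>y\<in>S. c * br f1 g y + br f2 g y)"
      using f gh by (intro ext closed F_lin lin)
    show "J (\<lambda>y\<in>S. c * f1 y + f2 y) g h x = c * J f1 g h x + J f2 g h x"
      unfolding J_def 1 2 lin[OF f closed[OF gh] x]
      by (subst (1 2) linR) (use f gh x in \<open>auto intro!: closed simp: algebra_simps\<close>)
  next
    fix f1 f2 assume f: "f1 \<in> F" "f2 \<in> F"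
    let ?l = "\<lambda>y\<in>S. f1 y * br h f2 y" and ?r = "\<lambda>y\<in>S. br h f1 y * f2 y"
    let ?l' = "\<lambda>y\<in>S. f1 y * br f2 g y" and ?r' = "\<lambda>y\<in>S. br f1 g y * f2 y"
    have 1: "br h (\<lambda>y\<in>S. f1 y * f2 y) = (\<lambda>y\<in>S. ?l y + ?r y)"
      using f gh leibR by (intro ext closed F_mult) auto
    have 2: "br (\<lambda>y\<in>S. f1 y * f2 y) g = (\<lambda>y\<in>S. ?l' y + ?r' y)"
      using f gh leib by (intro ext closed F_mult) auto
    have mem: "?l \<in> F" "?r \<in> F" "?l' \<in> F" "?r' \<in> F"
      by (intro F_mult closed f gh)+
    have g1: "br g (\<lambda>y\<in>S. ?l y + ?r y) x = f1 x * br g (br h f2) x + br g f1 x * br h f2 x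
        + (br h f1 x * br g f2 x + br g (br h f1) x * f2 x)"
      unfolding add[OF mem(1,2) gh(1) x] leibR[OF f(1) closed[OF gh(2) f(2)] gh(1) x]
        leibR[OF closed[OF gh(2) f(1)] f(2) gh(1) x] ..
    have h1: "br h (\<lambda>y\<in>S. ?l' y + ?r' y) x = f1 x * br h (br f2 g) x + br h f1 x * br f2 g x
        + (br f1 g x * br h f2 x + br h (br f1 g) x * f2 x)"
      unfolding add[OF mem(3,4) gh(2) x] leibR[OF f(1) closed[OF f(2) gh(1)] gh(2) x]
        leibR[OF closed[OF f(1) gh(1)] f(2) gh(2) x] ..
    \<comment> \<open>The products of two first-order brackets, such as
      \<open>br g f1 x * br h f2 x\<close>, occur once in \<open>g1\<close> and once in
      \<open>h1\<close> with the order inside one bracket reversed, so skew-symmetry cancels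
      them.\<close>
    show "J (\<lambda>y\<in>S. f1 y * f2 y) g h x = f1 x * J f2 g h x + J f1 g h x * f2 x"
      unfolding J_def 1 2 g1 h1 leib[OF f closed[OF gh] x]
      using skew[OF f(1) gh(1) x] skew[OF f(2) gh(1) x] by (simp add: algebra_simps)
  qed
  \<comment> \<open>Cyclic symmetry brings each argument to the first place, so one extension lemma
    frees all three arguments from \<open>E\<close>, one at a time.\<close>
  have cyc: "J f g h x = J g h f x" for f g h x
    by (simp add: J_def)
  have gen: "restrict e S \<in> F" if "e \<in> E" for e
    using that unfolding F_def by (auto intro: function_algebra.gen)
  have extend: "J f g h x = 0"
    if "\<And>e. e \<in> E \<Longrightarrow> J (restrict e S) g h x = 0" "g \<in> F" "h \<in> F" "x \<in> S" "f \<in> F" for f g h x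
    using derivation_at_eqI[OF that(4), of E I "\<lambda>f. J f g h x" "\<lambda>f. 0" f] J_der[OF that(2-4)] that inv
    unfolding F_def by (simp add: derivation_at_zero)
  have J1: "J f (restrict e S) (restrict e' S) x = 0" if "f \<in> F" "e \<in> E" "e' \<in> E" "x \<in> S" for f e e' x
  proof (rule extend)
    show "J (restrict e'' S) (restrict e S) (restrict e' S) x = 0" if "e'' \<in> E" for e''
      unfolding J_def using jacobi \<open>e \<in> E\<close> \<open>e' \<in> E\<close> \<open>x \<in> S\<close> that by simp
  qed (fact that gen[OF that(2)] gen[OF that(3)])+
  have J2: "J f (restrict e S) g x = 0" if "f \<in> F" "e \<in> E" "g \<in> F" "x \<in> S" for f g e x
  proof (rule extend)
    show "J (restrict e' S) (restrict e S) g x = 0" if "e' \<in> E" for e'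
      using J1[OF \<open>g \<in> F\<close> that \<open>e \<in> E\<close> \<open>x \<in> S\<close>] by (simp only: cyc[of g])
  qed (fact that gen[OF that(2)])+
  have J3: "J f g h x = 0" if "f \<in> F" "g \<in> F" "h \<in> F" "x \<in> S" for f g h x
  proof (rule extend)
    show "J (restrict e S) g h x = 0" if "e \<in> E" for e
      using J2[OF \<open>h \<in> F\<close> that \<open>g \<in> F\<close> \<open>x \<in> S\<close>] by (simp only: cyc[of h])
  qed (fact that)+
  show ?thesis
    unfolding poisson_structure_def
  proof (intro conjI ballI allI)
    show "br f (br g h) x + br g (br h f) x + br h (br f g) x = 0"
      if "f \<in> F" "g \<in> F" "h \<in> F" "x \<in> S" for f g h x
      using J3[OF that] by (simp only: J_def)
  qed (fact closed skew lin leib)+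
qed

section \<open>Exchange coefficients and the classical Yang-Baxter equation\<close>

definition sg :: "'a::linorder \<Rightarrow> 'a \<Rightarrow> complex" where
  "sg i j = (if i < j then - 1 else if i = j then 0 else 1)"

lemma sg_skew: "sg i j = - sg j i"
  by (auto simp: sg_def)

lemma sg_self [simp]: "sg i i = 0"
  by (simp add: sg_def)

text \<open>This is the modified Yang-Baxter equation for the skew part of the r-matrix, with its
  inhomogeneous constant 1. Applied to indices and to levels it yields two such constants, whose
  difference is what remains in \<open>exchange_coeff_yang_baxter\<close>.\<close>

lemma sg_cyclic:
  "sg j k * sg i k + sg i k * sg i j - sg i j * sg j k = (if i = j \<and> j = k then 0 else 1)"
  by (auto simp: sg_def)

text \<open>At one node, equal levels give the skew part of the r-matrix. Different levels add the
  permutation with sign +1 or -1, giving r or minus its flip.\<close>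

definition exchange_coeff ::
  "('s \<Rightarrow> int) \<Rightarrow> ('s \<Rightarrow> int) \<Rightarrow> 's \<Rightarrow> 's \<Rightarrow> 'n::linorder \<Rightarrow> 'n \<Rightarrow> complex" where
  "exchange_coeff node level s t i j =
     (if node s = node t then sg i j + sg (level s) (level t) else 0)"

lemma exchange_coeff_skew:
  "exchange_coeff node level s t i j = - exchange_coeff node level t s j i"
  using sg_skew[of i j] sg_skew[of "level s" "level t"] by (simp add: exchange_coeff_def)

definition yang_baxter ::
  "('s \<Rightarrow> 's \<Rightarrow> 'n \<Rightarrow> 'n \<Rightarrow> complex) \<Rightarrow> 's \<Rightarrow> 's \<Rightarrow> 's \<Rightarrow> 'n \<Rightarrow> 'n \<Rightarrow> 'n \<Rightarrow>
   ('n \<Rightarrow> 'n \<Rightarrow> 'n \<Rightarrow> complex) \<Rightarrow> complex" where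
  "yang_baxter c s t u i j k T =
     c t u j k * c s t i k * T k i j - c s t i j * c t u i k * T j k i
   + c t u j k * c s u i j * T j k i - c s u i k * c t u j i * T k i j
   + c s u i k * c s t k j * T j k i - c s t i j * c s u j k * T k i j"

text \<open>
  The equation \<open>[R\<^sub>t\<^sub>u, R\<^sub>s\<^sub>t] + [R\<^sub>t\<^sub>u, R\<^sub>s\<^sub>u] + [R\<^sub>s\<^sub>u, R\<^sub>s\<^sub>t] = 0\<close> for the operators
  \<open>(R\<^sub>s\<^sub>t T) (i, j) = c\<^sub>s\<^sub>t i j * T (j, i)\<close>, up to a term which appears only if \<open>s = t = u\<close>:
  there \<open>R\<close> is the skew-symmetric part of the \<open>r\<close>-matrix and solves the modified equation.
\<close>

lemma exchange_coeff_yang_baxter: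
  fixes T :: "'n::linorder \<Rightarrow> 'n \<Rightarrow> 'n \<Rightarrow> complex" and node level :: "'s \<Rightarrow> int"
  defines "c \<equiv> exchange_coeff node level"
  assumes inj: "inj (\<lambda>s. (node s, level s))"
  shows "yang_baxter c s t u i j k T = (if s = t \<and> t = u then T k i j - T j k i else 0)"
proof (cases "node s = node t \<and> node t = node u")
  case False
  then show ?thesis by (auto simp: yang_baxter_def c_def exchange_coeff_def)
next
  case True
  define st tu su where "st = sg (level s) (level t)" and "tu = sg (level t) (level u)"
    and "su = sg (level s) (level u)"
  have c: "c s t a b = sg a b + st" "c t u a b = sg a b + tu" "c s u a b = sg a b + su"
    for a b :: 'n
    using True by (simp_all add: c_def exchange_coeff_def st_def tu_def su_def)
  have level: "tu * su + su * st - st * tu = (if s = t \<and> t = u then 0 else 1)"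
    using sg_cyclic[of "level t" "level u" "level s"] True inj
    unfolding st_def tu_def su_def inj_def by auto
  have ijk: "sg j k * sg i k + sg i k * sg i j - sg i j * sg j k = (if i = j \<and> j = k then 0 else 1)"
    by (rule sg_cyclic)
  \<comment> \<open>Only two cyclic rearrangements of \<open>T\<close> occur, so their total
    coefficients suffice. Products of an index sign with a level sign cancel, leaving the difference
    of the two expressions of \<open>sg_cyclic\<close>; the coefficient of the other rearrangement
    is the opposite one.\<close>
  have "c t u j k * c s t i k - c s u i k * c t u j i - c s t i j * c s u j k
      = (sg j k * sg i k + sg i k * sg i j - sg i j * sg j k) - (tu * su + su * st - st * tu)"
    unfolding c sg_skew[of j i] by (simp add: algebra_simps)
  moreover have "c t u j k * c s u i j + c s u i k * c s t k j - c s t i j * c t u i k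
      = (tu * su + su * st - st * tu) - (sg j k * sg i k + sg i k * sg i j - sg i j * sg j k)"
    unfolding c sg_skew[of k j] by (simp add: algebra_simps)
  ultimately have "yang_baxter c s t u i j k T = ((sg j k * sg i k + sg i k * sg i j - sg i j * sg j k) - (tu * su + su * st - st * tu))
       * (T k i j - T j k i)"
    unfolding yang_baxter_def by algebra
  then show ?thesis unfolding ijk level by auto
qed

text \<open>
  \<open>exchange c s t X Y i i' m m'\<close> is the bracket of \<open>x\<^sub>i\<^sub>i\<^sub>'\<close> and \<open>y\<^sub>m\<^sub>m\<^sub>'\<close>; the row and column index of
  the matrix \<open>s\<close> sit in the slots \<open>(s, False)\<close> and \<open>(s, True)\<close>.
\<close>

definition exchange ::
  "('k \<times> bool \<Rightarrow> 'k \<times> bool \<Rightarrow> 'n \<Rightarrow> 'n \<Rightarrow> complex) \<Rightarrow> 'k \<Rightarrow> 'k \<Rightarrow>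
   'n::finite cmatrix \<Rightarrow> 'n cmatrix \<Rightarrow> 'n \<Rightarrow> 'n \<Rightarrow> 'n \<Rightarrow> 'n \<Rightarrow> complex" where
  "exchange c s t X Y i i' m m' =
     c (s, False) (t, False) i m * X $ m $ i' * Y $ i $ m'
   + c (s, False) (t, True) i m' * X $ m' $ i' * Y $ m $ i
   + c (s, True) (t, False) i' m * X $ i $ m * Y $ i' $ m'
   + c (s, True) (t, True) i' m' * X $ i $ m' * Y $ m $ i'"

lemma exchange_skew:
  assumes "\<And>s t i j. c s t i j = - c t s j i"
  shows "exchange c s t X Y i i' m m' = - exchange c t s Y X m m' i i'"
  unfolding exchange_def
  using assms[of "(s, False)" "(t, False)" i m] assms[of "(s, False)" "(t, True)" i m']
    assms[of "(s, True)" "(t, False)" i' m] assms[of "(s, True)" "(t, True)" i' m']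
  by (simp add: algebra_simps)

text \<open>The bracket of \<open>x\<^sub>i\<^sub>i\<^sub>'\<close> with the bracket of \<open>y\<^sub>j\<^sub>j\<^sub>'\<close> and \<open>z\<^sub>k\<^sub>k\<^sub>'\<close>.\<close>

definition exchange2 where
  "exchange2 c s t u X Y Z i i' j j' k k' =
     c (t, False) (u, False) j k *
       (exchange c s t X Y i i' k j' * Z $ j $ k' + Y $ k $ j' * exchange c s u X Z i i' j k')
   + c (t, False) (u, True) j k' *
       (exchange c s t X Y i i' k' j' * Z $ k $ j + Y $ k' $ j' * exchange c s u X Z i i' k j)
   + c (t, True) (u, False) j' k *
       (exchange c s t X Y i i' j k * Z $ j' $ k' + Y $ j $ k * exchange c s u X Z i i' j' k')
   + c (t, True) (u, True) j' k' *
       (exchange c s t X Y i i' j k' * Z $ k $ j' + Y $ j $ k' * exchange c s u X Z i i' k j')"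

lemma exchange_jacobi:
  fixes X Y Z :: "'n::finite cmatrix"
  assumes skew: "\<And>s t i j. c s t i j = - c t s j i"
    and yb: "\<And>s t u i j k (T :: 'n \<Rightarrow> 'n \<Rightarrow> 'n \<Rightarrow> complex).
      yang_baxter c s t u i j k T = (if s = t \<and> t = u then T k i j - T j k i else 0)"
    and eq: "s = t \<and> t = u \<Longrightarrow> X = Y \<and> Y = Z"
  shows "exchange2 c s t u X Y Z i i' j j' k k' + exchange2 c t u s Y Z X j j' k k' i i'
       + exchange2 c u s t Z X Y k k' i i' j j' = 0"
proof -
  \<comment> \<open>Only the ordered pairs (s, t), (t, u), (s, u) are kept, reversed ones being
    rewritten by skewness. What is left is a polynomial identity in independent symbols, with one
    Yang-Baxter expression for each of the 2 * 2 * 2 choices of slots.\<close>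
  define st tu su where "st a b = c (s, a) (t, b)" and "tu a b = c (t, a) (u, b)"
    and "su a b = c (s, a) (u, b)" for a b
  have cs: "c (s, a) (t, b) = st a b" "c (t, a) (u, b) = tu a b" "c (s, a) (u, b) = su a b" for a b
    by (simp_all add: st_def tu_def su_def)
  have ts: "c (t, a) (s, b) p q = - st b a q p" "c (u, a) (t, b) p q = - tu b a q p"
    "c (u, a) (s, b) p q = - su b a q p" for a b p q
    unfolding st_def tu_def su_def by (rule skew)+
  have exch: "exchange c t s Y X a b d e = - exchange c s t X Y d e a b"
    "exchange c u t Z Y a b d e = - exchange c t u Y Z d e a b"
    "exchange c u s Z X a b d e = - exchange c s u X Z d e a b" for a b d e
    by (rule exchange_skew, rule skew)+
  have "exchange2 c s t u X Y Z i i' j j' k k' + exchange2 c t u s Y Z X j j' k k' i i'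
       + exchange2 c u s t Z X Y k k' i i' j j'
     = yang_baxter c (s, False) (t, False) (u, False) i j k
         (\<lambda>a b d. X $ a $ i' * Y $ b $ j' * Z $ d $ k')
     + yang_baxter c (s, False) (t, False) (u, True) i j k'
         (\<lambda>a b d. X $ a $ i' * Y $ b $ j' * Z $ k $ d)
     + yang_baxter c (s, False) (t, True) (u, False) i j' k
         (\<lambda>a b d. X $ a $ i' * Y $ j $ b * Z $ d $ k')
     + yang_baxter c (s, False) (t, True) (u, True) i j' k'
         (\<lambda>a b d. X $ a $ i' * Y $ j $ b * Z $ k $ d)
     + yang_baxter c (s, True) (t, False) (u, False) i' j k
         (\<lambda>a b d. X $ i $ a * Y $ b $ j' * Z $ d $ k')
     + yang_baxter c (s, True) (t, False) (u, True) i' j k'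
         (\<lambda>a b d. X $ i $ a * Y $ b $ j' * Z $ k $ d)
     + yang_baxter c (s, True) (t, True) (u, False) i' j' k
         (\<lambda>a b d. X $ i $ a * Y $ j $ b * Z $ d $ k')
     + yang_baxter c (s, True) (t, True) (u, True) i' j' k'
         (\<lambda>a b d. X $ i $ a * Y $ j $ b * Z $ k $ d)"
    unfolding exchange2_def exch unfolding exchange_def yang_baxter_def ts cs
    by (simp add: algebra_simps)
  also have "\<dots> = 0"
    \<comment> \<open>Triples mixing rows and columns give 0. If the three matrices coincide, the
      first monomial of the all-row remainder is, after reordering its factors, the second one of
      the all-column remainder, and conversely, so the opposite signs cancel.\<close>
    using eq by (auto simp: yb algebra_simps)
  finally show ?thesis .
qed

section \<open>Entries of the tensors in the bracket formulas\<close>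

lemma kron_nth: "kron X Y $ p $ q = X $ fst p $ fst q * Y $ snd p $ snd q"
  by (simp add: kron_def)

lemma sum_UNIV_prod:
  fixes f :: "'a::finite \<times> 'b::finite \<Rightarrow> 'c::comm_monoid_add"
  shows "(\<Sum>p\<in>UNIV. f p) = (\<Sum>a\<in>UNIV. \<Sum>b\<in>UNIV. f (a, b))"
  by (simp add: sum.cartesian_product UNIV_Times_UNIV[symmetric] del: UNIV_Times_UNIV)

lemma leg1_mult_nth:
  "(leg1 X ** M) $ (i, k) $ q = (\<Sum>a\<in>UNIV. X $ i $ a * M $ (a, k) $ q)"
  by (simp add: matrix_matrix_mult_def sum_UNIV_prod kron_nth mat_def mult.assoc
      if_distrib if_distribR cong: if_cong)

lemma leg2_mult_nth:
  "(leg2 X ** M) $ (i, k) $ q = (\<Sum>a\<in>UNIV. X $ k $ a * M $ (i, a) $ q)"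
  by (simp add: matrix_matrix_mult_def sum_UNIV_prod kron_nth mat_def mult.assoc
      if_distrib if_distribR cong: if_cong)
    (subst sum.swap, simp add: if_distrib if_distribR cong: if_cong)

lemma mult_leg1_nth:
  "(M ** leg1 X) $ p $ (j, l) = (\<Sum>a\<in>UNIV. M $ p $ (a, l) * X $ a $ j)"
  by (simp add: matrix_matrix_mult_def sum_UNIV_prod kron_nth mat_def mult.assoc
      if_distrib if_distribR cong: if_cong)

lemma mult_leg2_nth:
  "(M ** leg2 X) $ p $ (j, l) = (\<Sum>a\<in>UNIV. M $ p $ (j, a) * X $ a $ l)"
  by (simp add: matrix_matrix_mult_def sum_UNIV_prod kron_nth mat_def mult.assoc
      if_distrib if_distribR cong: if_cong)
    (subst sum.swap, simp add: if_distrib if_distribR cong: if_cong)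

lemma leg1_leg2_nth: "(leg1 X ** leg2 Y) $ (i, k) $ (j, l) = X $ i $ j * Y $ k $ l"
  by (simp add: leg1_mult_nth kron_nth) (simp add: mat_def if_distrib if_distribR cong: if_cong)

text \<open>The weight \<open>1 + sg i k\<close> packs the three cases of the definition: 2 below
  the diagonal, 1 on it, 0 above. In this form the r-matrix is a weighted flip of the two
  legs.\<close>

lemma r_matrix_nth:
  "r_matrix $ (i, k) $ (j, l) = (if j = k \<and> l = i then 1 + sg i k else 0)"
proof -
  have "(\<Sum>a\<in>UNIV. kron (matrix_unit a a) (matrix_unit a a)) $ (i, k) $ (j, l)
      = (\<Sum>a\<in>UNIV. kron (matrix_unit a a) (matrix_unit a a) $ (i, k) $ (j, l) :: complex)"
    by simp
  also have "\<dots> = (\<Sum>a\<in>UNIV. if a = i then (if i = j \<and> i = k \<and> i = l then 1 else 0) else 0)"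
    by (rule sum.cong) (auto simp: kron_nth matrix_unit_def)
  finally have "(\<Sum>a\<in>UNIV. kron (matrix_unit a a) (matrix_unit a a)) $ (i, k) $ (j, l)
      = (if i = j \<and> i = k \<and> i = l then 1 else 0 :: complex)"
    by simp
  moreover have "(\<Sum>(a, b)\<in>{(a, b). a > b}. kron (matrix_unit a b) (matrix_unit b a)) $ (i, k) $ (j, l)
      = (if j = k \<and> l = i \<and> i > k then 1 else 0 :: complex)"
  proof -
    have "(\<Sum>(a, b)\<in>{(a, b). a > b}. kron (matrix_unit a b) (matrix_unit b a)) $ (i, k) $ (j, l)
        = (\<Sum>(a, b)\<in>{(a, b). a > b}. kron (matrix_unit a b) (matrix_unit b a) $ (i, k) $ (j, l) :: complex)"
      by (simp add: split_def)
    also have "\<dots> = (\<Sum>p\<in>{(a, b). a > b}. if p = (i, k) then (if j = k \<and> l = i then 1 else 0) else 0)"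
      by (rule sum.cong) (auto simp: kron_nth matrix_unit_def split: if_splits)
    finally show ?thesis by simp
  qed
  ultimately show ?thesis
    by (auto simp: r_matrix_def sg_def scaleR_conv_of_real)
qed

lemma r_matrix_mult_nth: "(r_matrix ** M) $ (i, k) $ q = (1 + sg i k) * M $ (k, i) $ q"
proof -
  have "(r_matrix ** M) $ (i, k) $ q
      = (\<Sum>p\<in>UNIV. if p = (k, i) then (1 + sg i k) * M $ (k, i) $ q else 0)"
    unfolding matrix_matrix_mult_def
    unfolding vec_lambda_beta by (intro sum.cong refl) (auto simp: r_matrix_nth split: if_splits)
  then show ?thesis by simp
qed

lemma mult_r_matrix_nth: "(M ** r_matrix) $ p $ (j, l) = M $ p $ (l, j) * (1 + sg l j)"
proof -
  have "(M ** r_matrix) $ p $ (j, l)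
      = (\<Sum>q\<in>UNIV. if q = (l, j) then M $ p $ (l, j) * (1 + sg l j) else 0)"
    unfolding matrix_matrix_mult_def
    unfolding vec_lambda_beta by (intro sum.cong refl) (auto simp: r_matrix_nth split: if_splits)
  then show ?thesis by simp
qed

lemma transp1_r_matrix_nth:
  "transp1 r_matrix $ (i, k) $ (j, l) = (if i = k \<and> j = l then 1 + sg j k else 0)"
  by (auto simp: transp1_def r_matrix_nth)

lemma transp2_r_matrix_nth:
  "transp2 r_matrix $ (i, k) $ (j, l) = (if i = k \<and> j = l then 1 + sg k j else 0)"
  by (auto simp: transp2_def r_matrix_nth)

text \<open>The two constants 1 of the flip weights cancel, since the flip commutes with B \<otimes>
  B.\<close>

lemma BB_rhs_nth: "BB_rhs B $ (i, k) $ (j, l) = (sg i k + sg j l) * B $ i $ l * B $ k $ j"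
  using sg_skew[of l j]
  by (simp add: BB_rhs_def matrix_mul_assoc[symmetric] r_matrix_mult_nth mult_r_matrix_nth
      leg1_leg2_nth algebra_simps)
    (simp add: matrix_mul_assoc mult_r_matrix_nth leg1_leg2_nth algebra_simps)

lemma sum_sum_if_eq:
  fixes f :: "'n::finite \<Rightarrow> 'n \<Rightarrow> complex"
  shows "(\<Sum>a\<in>UNIV. \<Sum>b\<in>UNIV. if a = x \<and> b = y then f a b else 0) = f x y"
proof -
  have "(\<Sum>a\<in>UNIV. \<Sum>b\<in>UNIV. if a = x \<and> b = y then f a b else 0)
      = (\<Sum>a\<in>UNIV. if a = x then f x y else 0)"
    by (intro sum.cong refl) simp
  then show ?thesis by simp
qed

text \<open>The hypothesis describes a partially transposed weighted flip: it forces both summation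
  indices of the product, so a single monomial survives. The two lemmas below treat the other
  positions of the legs in the same way.\<close>

lemma leg1_exchange_leg2_nth:
  fixes Q :: "'n::finite tensor"
  assumes "\<And>i k j l. Q $ (i, k) $ (j, l) = (if i = k \<and> j = l then c j k else 0)"
  shows "(leg1 X ** Q ** leg2 Y) $ (i, k) $ (j, l) = c j k * X $ i $ k * Y $ j $ l"
proof -
  have "(leg1 X ** Q ** leg2 Y) $ (i, k) $ (j, l)
      = (\<Sum>a\<in>UNIV. \<Sum>b\<in>UNIV. if a = j \<and> b = k then X $ i $ b * c a b * Y $ a $ l else 0)"
    unfolding mult_leg2_nth leg1_mult_nth sum_distrib_right assms
    by (intro sum.cong refl) auto
  also have "\<dots> = c j k * X $ i $ k * Y $ j $ l"
    by (subst sum_sum_if_eq) (simp add: mult_ac)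
  finally show ?thesis .
qed

lemma leg2_exchange_leg1_nth:
  fixes Q :: "'n::finite tensor"
  assumes "\<And>i k j l. Q $ (i, k) $ (j, l) = (if i = k \<and> j = l then c j k else 0)"
  shows "(leg2 X ** Q ** leg1 Y) $ (i, k) $ (j, l) = c l i * X $ k $ i * Y $ l $ j"
proof -
  have "(leg2 X ** Q ** leg1 Y) $ (i, k) $ (j, l)
      = (\<Sum>a\<in>UNIV. \<Sum>b\<in>UNIV. if a = l \<and> b = i then X $ k $ b * c a b * Y $ a $ j else 0)"
    unfolding mult_leg1_nth leg2_mult_nth sum_distrib_right assms
    by (intro sum.cong refl) auto
  also have "\<dots> = c l i * X $ k $ i * Y $ l $ j"
    by (subst sum_sum_if_eq) (simp add: mult_ac)
  finally show ?thesis .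
qed

lemma leg1_leg2_exchange_nth:
  fixes Q :: "'n::finite tensor"
  assumes "\<And>i k j l. Q $ (i, k) $ (j, l) = (if i = k \<and> j = l then c j k else 0)"
  shows "(leg1 X ** leg2 Y ** transp2 Q) $ (i, k) $ (j, l) = c j l * X $ i $ l * Y $ k $ j"
proof -
  have "(leg1 X ** leg2 Y ** transp2 Q) $ (i, k) $ (j, l)
      = (\<Sum>a\<in>UNIV. \<Sum>b\<in>UNIV. if a = l \<and> b = j then X $ i $ a * Y $ k $ b * c b a else 0)"
    unfolding matrix_matrix_mult_def[of "leg1 X ** leg2 Y"] sum_UNIV_prod leg1_leg2_nth vec_lambda_beta
      transp2_def fst_conv snd_conv assms
    by (intro sum.cong refl) auto
  also have "\<dots> = c j l * X $ i $ l * Y $ k $ j"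
    by (subst sum_sum_if_eq) (simp add: mult_ac)
  finally show ?thesis .
qed

text \<open>Here the constants of the flip survive because of the partial transposition. The +1 and
  -1 say that the column slot of a form lies one level above its row slot.\<close>

lemma AA_rhs_nth:
  "AA_rhs A $ (i, k) $ (j, l) = (sg i k + sg j l) * A $ i $ l * A $ k $ j
     + (sg j k + 1) * A $ i $ k * A $ j $ l + (sg i l - 1) * A $ k $ i * A $ l $ j"
proof -
  have "AA_rhs A $ (i, k) $ (j, l) = BB_rhs A $ (i, k) $ (j, l)
     + (leg1 A ** transp1 r_matrix ** leg2 A) $ (i, k) $ (j, l)
     - (leg2 A ** transp1 r_matrix ** leg1 A) $ (i, k) $ (j, l)"
    by (simp add: AA_rhs_def BB_rhs_def)
  then show ?thesis
    unfolding BB_rhs_nth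
      leg1_exchange_leg2_nth[of "transp1 r_matrix" "\<lambda>j k. 1 + sg j k", OF transp1_r_matrix_nth]
      leg2_exchange_leg1_nth[of "transp1 r_matrix" "\<lambda>j k. 1 + sg j k", OF transp1_r_matrix_nth]
    using sg_skew[of l i] by (simp add: algebra_simps)
qed

text \<open>For a tensor in \<open>Q_types\<close> these are the only entries that can be
  nonzero.\<close>

definition Q_coeff :: "'n::{finite,linorder} tensor \<Rightarrow> 'n \<Rightarrow> 'n \<Rightarrow> complex" where
  "Q_coeff Q j k = Q $ (k, k) $ (j, j)"

text \<open>The levels 2 and -1 lie above and below both levels 0 and 1 taken by the row and column
  of \<open>A\<close>; row slots of the other matrices have level 0. For \<open>Q = 0\<close> the
  value -1 is a default: \<open>slot_node\<close> then gives the slot a node of its own.\<close>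

definition Q_level :: "'n::{finite,linorder} tensor \<Rightarrow> int" where
  "Q_level Q = (if Q = transp1 r_matrix then 2 else - 1)"

lemma Q_types_nth:
  fixes Q :: "'n::{finite,linorder} tensor"
  assumes "Q \<in> Q_types"
  shows "Q $ (i, k) $ (j, l) = (if i = k \<and> j = l then Q_coeff Q j k else 0)"
  using assms unfolding Q_types_def Q_coeff_def
  by (auto simp: transp1_r_matrix_nth transp2_r_matrix_nth)

lemma Q_coeff_eq:
  fixes Q :: "'n::{finite,linorder} tensor"
  assumes "Q \<in> Q_types"
  shows "Q_coeff Q j k = (if Q = 0 then 0 else sg j k + sg (Q_level Q) 0)"
proof -
  fix i :: 'n
  \<comment> \<open>A diagonal entry tells the three types apart: it is 1, -1 or 0. Hence the case
    distinctions on \<open>Q\<close> below are unambiguous.\<close>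
  have "transp1 r_matrix $ (i, i) $ (i, i) \<noteq> 0" and "(- transp2 r_matrix) $ (i, i) $ (i, i) \<noteq> 0"
    and "(- transp2 r_matrix) $ (i, i) $ (i, i) \<noteq> transp1 r_matrix $ (i, i) $ (i, i)"
    by (simp_all add: transp1_r_matrix_nth transp2_r_matrix_nth)
  then have ne: "transp1 r_matrix \<noteq> (0 :: 'n tensor)" "- transp2 r_matrix \<noteq> (0 :: 'n tensor)"
    "- transp2 r_matrix \<noteq> (transp1 r_matrix :: 'n tensor)"
    by (metis zero_index)+ 
  consider "Q = 0" | "Q = - transp2 r_matrix" | "Q = transp1 r_matrix"
    using assms unfolding Q_types_def by blast
  then show ?thesis
  proof cases
    case 1
    then show ?thesis by (simp add: Q_coeff_def)
  next
    case 2
    then have "Q_coeff Q j k = - (1 + sg k j)"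
      by (simp add: Q_coeff_def transp2_r_matrix_nth)
    moreover have "sg (Q_level Q) 0 = - 1" using 2 ne by (simp add: Q_level_def sg_def)
    ultimately show ?thesis using 2 ne sg_skew[of k j] by simp
  next
    case 3
    then have "Q_coeff Q j k = 1 + sg j k"
      by (simp add: Q_coeff_def transp1_r_matrix_nth)
    moreover have "sg (Q_level Q) 0 = 1" using 3 by (simp add: Q_level_def sg_def)
    ultimately show ?thesis using 3 ne by simp
  qed
qed

lemma Q_leg1_leg2_nth:
  fixes Q :: "'n::{finite,linorder} tensor"
  assumes "Q \<in> Q_types"
  shows "(leg1 X ** Q ** leg2 Y) $ (i, k) $ (j, l) = Q_coeff Q j k * X $ i $ k * Y $ j $ l"
  by (rule leg1_exchange_leg2_nth) (rule Q_types_nth[OF assms])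

lemma BA_rhs_nth:
  fixes Q :: "'n::{finite,linorder} tensor"
  assumes "Q \<in> Q_types"
  shows "BA_rhs Q B A $ (i, k) $ (j, l)
     = Q_coeff Q j k * B $ i $ k * A $ j $ l + Q_coeff Q j l * B $ i $ l * A $ k $ j"
  using Q_leg1_leg2_nth[OF assms] leg1_leg2_exchange_nth[of Q "Q_coeff Q", OF Q_types_nth[OF assms]]
  by (simp add: BA_rhs_def)

section \<open>The brackets of the coordinates on the space of chains\<close>

text \<open>
  Two slots interact if they sit at the same node.  The matrix \<open>A\<close> has index \<open>0\<close> and both its
  slots sit at node \<open>0\<close>; the row slot of \<open>B\<^sub>k\<close> sits at node \<open>k\<close> and its column slot at node
  \<open>k - 1\<close>, unless \<open>Q\<^bsup>[k-1]\<^esup> = 0\<close>, when the column slot is moved to the separate node \<open>-k\<close>.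
\<close>

definition slot_node :: "(nat \<Rightarrow> 'n::{finite,linorder} tensor) \<Rightarrow> nat \<times> bool \<Rightarrow> int" where
  "slot_node Q s = (case s of (k, is_col) \<Rightarrow>
     if is_col \<and> k \<noteq> 0 then (if Q (k - 1) = 0 then - int k else int k - 1) else int k)"

definition slot_level :: "(nat \<Rightarrow> 'n::{finite,linorder} tensor) \<Rightarrow> nat \<times> bool \<Rightarrow> int" where
  "slot_level Q s = (case s of (k, is_col) \<Rightarrow>
     if is_col then (if k = 0 then 1 else Q_level (Q (k - 1))) else 0)"

definition chain_coeff ::
  "(nat \<Rightarrow> 'n::{finite,linorder} tensor) \<Rightarrow> nat \<times> bool \<Rightarrow> nat \<times> bool \<Rightarrow> 'n \<Rightarrow> 'n \<Rightarrow> complex" where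
  "chain_coeff Q = exchange_coeff (slot_node Q) (slot_level Q)"

text \<open>Node 0 holds the row and column of \<open>A\<close> (levels 0 and 1) and possibly the
  column of the first B (level -1 or 2). A node k > 0 holds the row of \<open>B\<^sub>k\<close>
  (level 0) and possibly the column of its successor (level -1 or 2), and a negative node holds one
  column. So distinct slots at a node are separated by level, and the inhomogeneous Yang-Baxter term
  is confined to coinciding slots.\<close>

lemma inj_slot: "inj (\<lambda>s. (slot_node Q s, slot_level Q s))"
  by (auto simp: inj_def slot_node_def slot_level_def Q_level_def split: if_splits)

lemma chain_coeff_skew: "chain_coeff Q s t i j = - chain_coeff Q t s j i"
  unfolding chain_coeff_def by (rule exchange_coeff_skew)

lemma exchange_AA:
  "exchange (chain_coeff Q) 0 0 A A i j k l = AA_rhs A $ (i, k) $ (j, l)"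
  by (simp add: exchange_def chain_coeff_def exchange_coeff_def slot_node_def slot_level_def
      AA_rhs_nth algebra_simps) (simp add: sg_def)

lemma exchange_BB:
  assumes "m \<noteq> 0"
  shows "exchange (chain_coeff Q) m m B B i j k l = BB_rhs B $ (i, k) $ (j, l)"
  using assms
  by (simp add: exchange_def chain_coeff_def exchange_coeff_def slot_node_def slot_level_def
      BB_rhs_nth algebra_simps)

text \<open>\<open>BA_rhs\<close> couples B to the row and to the column of A by the same tensor.
  This works because \<open>Q_level\<close> compares in the same way with the levels 0 and
  1.\<close>

lemma exchange_BA:
  assumes "Q 0 \<in> Q_types"
  shows "exchange (chain_coeff Q) 1 0 B A i j k l = BA_rhs (Q 0) B A $ (i, k) $ (j, l)"
  by (simp add: exchange_def chain_coeff_def exchange_coeff_def slot_node_def slot_level_def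
      BA_rhs_nth[OF assms] Q_coeff_eq[OF assms] algebra_simps)
    (simp add: sg_def Q_level_def)

lemma exchange_B_Suc_B:
  assumes "Q m \<in> Q_types" "m \<noteq> 0"
  shows "exchange (chain_coeff Q) (m + 1) m B B' i j k l
     = (leg1 B ** Q m ** leg2 B') $ (i, k) $ (j, l)"
  using assms(2)
  by (simp add: exchange_def chain_coeff_def exchange_coeff_def slot_node_def slot_level_def
      Q_leg1_leg2_nth[OF assms(1)] Q_coeff_eq[OF assms(1)])

lemma exchange_zero:
  assumes "l + 1 < m"
  shows "exchange (chain_coeff Q) m l X Y i i' k k' = 0"
  using assms
  by (simp add: exchange_def chain_coeff_def exchange_coeff_def slot_node_def)

section \<open>The Poisson structure on the space of chains\<close>

definition chain_matrix :: "nat \<Rightarrow> 'n::finite chain \<Rightarrow> 'n cmatrix" where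
  "chain_matrix k x = (if k = 0 then fst x else chain_B k x)"

definition chain_coord :: "nat \<times> 'n \<times> 'n \<Rightarrow> 'n::finite chain \<Rightarrow> complex" where
  "chain_coord = (\<lambda>(k, a, b) x. chain_matrix k x $ a $ b)"

definition chain_indices :: "nat \<Rightarrow> (nat \<times> 'n::finite \<times> 'n) set" where
  "chain_indices j = {0..j} \<times> UNIV"

definition chain_inverse_dets :: "nat \<Rightarrow> ('n::finite chain \<Rightarrow> complex) set" where
  "chain_inverse_dets j = {\<lambda>x. inverse (det (chain_B k x)) | k. k \<in> {1..j}}"

lemma finite_chain_indices [simp]: "finite (chain_indices j)"
  by (simp add: chain_indices_def)

lemma chain_functions_eq:
  "chain_functions j = function_algebra (chain_space j)
     (chain_coord ` chain_indices j \<union> chain_inverse_dets j)"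
proof -
  have "({\<lambda>x. fst x $ a $ b | a b. True} \<union> {\<lambda>x. chain_B k x $ a $ b | k a b. k \<in> {1..j}}
      :: ('a chain \<Rightarrow> complex) set) = chain_coord ` chain_indices j" (is "?A \<union> ?B = ?C")
  proof (intro antisym subsetI)
    fix f assume "f \<in> ?A \<union> ?B"
    then consider a b where "f = (\<lambda>x. fst x $ a $ b)"
      | k a b where "f = (\<lambda>x. chain_B k x $ a $ b)" "k \<in> {1..j}"
      by blast
    then show "f \<in> ?C"
    proof cases
      case 1
      then have "f = chain_coord (0, a, b)" by (simp add: chain_coord_def chain_matrix_def)
      then show ?thesis by (auto simp: chain_indices_def)
    next
      case 2
      then have "f = chain_coord (k, a, b)" by (auto simp: chain_coord_def chain_matrix_def)
      then show ?thesis using 2(2) by (auto simp: chain_indices_def)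
    qed
  next
    fix f :: "'a chain \<Rightarrow> complex" assume "f \<in> ?C"
    then obtain k a b where f: "f = chain_coord (k, a, b)" and "k \<le> j"
      by (auto simp: chain_indices_def)
    show "f \<in> ?A \<union> ?B"
    proof (cases "k = 0")
      case True
      then show ?thesis unfolding f by (auto simp: chain_coord_def chain_matrix_def)
    next
      case False
      then have "k \<in> {1..j}" "f = (\<lambda>x. chain_B k x $ a $ b)"
        using \<open>k \<le> j\<close> unfolding f by (auto simp: chain_coord_def chain_matrix_def)
      then show ?thesis by blast
    qed
  qed
  then show ?thesis
    unfolding chain_functions_def chain_inverse_dets_def by simp
qed

lemma chain_coord_in:
  "a \<in> chain_indices j \<Longrightarrow> restrict (chain_coord a) (chain_space j) \<in> chain_functions j"
  unfolding chain_functions_eq by (auto intro: function_algebra.gen)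

lemma chain_matrix_in:
  "k \<le> j \<Longrightarrow> (\<lambda>x\<in>chain_space j. chain_matrix k x $ a $ b) \<in> chain_functions j"
  using chain_coord_in[of "(k, a, b)" j] by (simp add: chain_coord_def chain_indices_def)

text \<open>Supplies the hypothesis \<open>inv\<close> of the extension lemmas: the determinant is a
  polynomial in the coordinates and does not vanish on chains.\<close>

lemma chain_inverse_dets_inverse:
  assumes "g \<in> chain_inverse_dets j"
  shows "\<exists>h. restrict h (chain_space j) \<in> function_algebra (chain_space j) (chain_coord ` chain_indices j)
    \<and> (\<forall>x\<in>chain_space j. g x * h x = 1)"
proof -
  obtain k where g: "g = (\<lambda>x. inverse (det (chain_B k x)))" and k: "k \<in> {1..j}"
    using assms by (auto simp: chain_inverse_dets_def)
  have "(\<lambda>x\<in>chain_space j. chain_B k x $ a $ b)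
      \<in> function_algebra (chain_space j) (chain_coord ` chain_indices j)" for a b
  proof -
    have "chain_coord (k, a, b) \<in> chain_coord ` chain_indices j"
      using k by (auto simp: chain_indices_def)
    then have "restrict (chain_coord (k, a, b)) (chain_space j)
        \<in> function_algebra (chain_space j) (chain_coord ` chain_indices j)"
      by (rule function_algebra.gen)
    then show ?thesis using k by (simp add: chain_coord_def chain_matrix_def)
  qed
  then have "(\<lambda>x\<in>chain_space j. det (chain_B k x))
      \<in> function_algebra (chain_space j) (chain_coord ` chain_indices j)"
    by (rule function_algebra_det)
  moreover have "g x * det (chain_B k x) = 1" if "x \<in> chain_space j" for x
  proof -
    have "chain_B k x \<in> GL" using that k by (auto simp: chain_space_def)
    then show ?thesis by (simp add: g GL_def invertible_det_nz)
  qed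
  ultimately show ?thesis by blast
qed

section \<open>Partial derivatives of regular functions along the coordinates\<close>

definition mat_shift :: "'n \<Rightarrow> 'n \<Rightarrow> complex \<Rightarrow> 'n::finite cmatrix \<Rightarrow> 'n cmatrix" where
  "mat_shift i i' t X = (\<chi> a b. X $ a $ b + (if a = i \<and> b = i' then t else 0))"

definition chain_shift :: "nat \<times> 'n \<times> 'n \<Rightarrow> complex \<Rightarrow> 'n::finite chain \<Rightarrow> 'n chain" where
  "chain_shift = (\<lambda>(k, i, i') t x.
     if k = 0 then (mat_shift i i' t (fst x), snd x)
     else (fst x, (snd x)(k := mat_shift i i' t (chain_B k x))))"

text \<open>Differentiating along a coordinate line depends only on the function, not on an
  expression for it, so nothing has to be shown well defined.\<close>

definition chain_partial :: "nat \<times> 'n \<times> 'n \<Rightarrow> ('n::finite chain \<Rightarrow> complex) \<Rightarrow> 'n chain \<Rightarrow> complex" where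
  "chain_partial a f x = deriv (\<lambda>t. f (chain_shift a t x)) 0"

lemma mat_shift_0 [simp]: "mat_shift i i' 0 X = X"
  by (simp add: mat_shift_def vec_eq_iff)

lemma chain_shift_0 [simp]: "chain_shift a 0 x = x"
  by (simp add: chain_shift_def split_def)

lemma chain_coord_shift:
  "chain_coord b (chain_shift a t x) = chain_coord b x + (if b = a then t else 0)"
  by (auto simp: chain_coord_def chain_shift_def chain_matrix_def mat_shift_def split: prod.splits)

lemma chain_partial_coord: "chain_partial a (chain_coord b) x = (if a = b then 1 else 0)"
  by (simp add: chain_partial_def chain_coord_shift)

text \<open>Openness of \<open>GL\<close>: the determinant stays nonzero for small \<open>t\<close>.
  Without it the derivative at 0 would see the value \<open>undefined\<close> that restricted
  functions take outside the chain space.\<close>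

lemma eventually_chain_shift:
  assumes "x \<in> chain_space j" "a \<in> chain_indices j"
  shows "eventually (\<lambda>t. chain_shift a t x \<in> chain_space j) (nhds 0)"
proof -
  obtain k i i' where a: "a = (k, i, i')" and k: "k \<le> j"
    using assms(2) by (auto simp: chain_indices_def)
  show ?thesis
  proof (cases "k = 0")
    case True
    then have "chain_shift a t x \<in> chain_space j" for t
      using assms(1) by (auto simp: a chain_shift_def chain_space_def)
    then show ?thesis by simp
  next
    case False
    have entry: "((\<lambda>t. chain_B k x $ r $ s + (if r = i \<and> s = i' then t else 0))
        \<longlongrightarrow> chain_B k x $ r $ s + (if r = i \<and> s = i' then 0 else 0)) (nhds 0)" for r s
      by (intro tendsto_intros) (cases "r = i \<and> s = i'"; auto simp: filterlim_ident)
    then have "((\<lambda>t. det (mat_shift i i' t (chain_B k x))) \<longlongrightarrow> det (mat_shift i i' 0 (chain_B k x))) (nhds 0)"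
      unfolding det_def mat_shift_def vec_lambda_beta
      by (intro tendsto_sum tendsto_mult tendsto_prod tendsto_const entry)
    moreover have "det (chain_B k x) \<noteq> 0"
    proof -
      have "chain_B k x \<in> GL" using assms(1) k False by (auto simp: chain_space_def)
      then show ?thesis by (simp add: GL_def invertible_det_nz)
    qed
    ultimately have "eventually (\<lambda>t. det (mat_shift i i' t (chain_B k x)) \<noteq> 0) (nhds 0)"
      using tendsto_imp_eventually_ne by fastforce
    then show ?thesis
    proof eventually_elim
      case (elim t)
      then show ?case
        using assms(1) k False
        by (auto simp: a chain_shift_def chain_space_def GL_def invertible_det_nz PiE_iff
            extensional_def)
    qed
  qed
qed

lemma eventually_restrict_chain_shift:
  assumes "x \<in> chain_space j" "a \<in> chain_indices j"
  shows "eventually (\<lambda>t. restrict f (chain_space j) (chain_shift a t x) = f (chain_shift a t x)) (nhds 0)"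
  using eventually_chain_shift[OF assms] by eventually_elim simp

lemma chain_partial_restrict:
  assumes "x \<in> chain_space j" "a \<in> chain_indices j"
  shows "chain_partial a (restrict f (chain_space j)) x = chain_partial a f x"
  unfolding chain_partial_def
  by (rule deriv_cong_ev[OF eventually_restrict_chain_shift[OF assms] refl])

definition chain_differentiable :: "nat \<Rightarrow> ('n::finite chain \<Rightarrow> complex) \<Rightarrow> bool" where
  "chain_differentiable j f \<longleftrightarrow> (\<forall>x\<in>chain_space j. \<forall>a\<in>chain_indices j.
     (\<lambda>t. f (chain_shift a t x)) field_differentiable at 0)"

lemma chain_differentiable_restrict:
  fixes f :: "'a::finite chain \<Rightarrow> complex"
  assumes "chain_differentiable j f"
  shows "chain_differentiable j (restrict f (chain_space j))"
  unfolding chain_differentiable_def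
proof (intro ballI)
  fix x :: "'a chain" and a :: "nat \<times> 'a \<times> 'a" assume xa: "x \<in> chain_space j" "a \<in> chain_indices j"
  then have "(\<lambda>t. f (chain_shift a t x)) field_differentiable at 0"
    using assms by (simp add: chain_differentiable_def)
  then obtain D where "((\<lambda>t. f (chain_shift a t x)) has_field_derivative D) (at 0)"
    by (auto simp: field_differentiable_def)
  then have "((\<lambda>t. restrict f (chain_space j) (chain_shift a t x)) has_field_derivative D) (at 0)"
    using DERIV_cong_ev[OF refl eventually_restrict_chain_shift[OF xa, of f] refl] by simp
  then show "(\<lambda>t. restrict f (chain_space j) (chain_shift a t x)) field_differentiable at 0"
    by (auto simp: field_differentiable_def)
qed

lemma chain_partial_add:
  assumes "chain_differentiable j f" "chain_differentiable j g" "x \<in> chain_space j" "a \<in> chain_indices j"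
  shows "chain_partial a (\<lambda>x\<in>chain_space j. f x + g x) x = chain_partial a f x + chain_partial a g x"
  unfolding chain_partial_restrict[OF assms(3,4)] using assms
  by (simp add: chain_partial_def chain_differentiable_def)

lemma chain_partial_mult:
  assumes "chain_differentiable j f" "chain_differentiable j g" "x \<in> chain_space j" "a \<in> chain_indices j"
  shows "chain_partial a (\<lambda>x\<in>chain_space j. f x * g x) x
     = f x * chain_partial a g x + chain_partial a f x * g x"
  unfolding chain_partial_restrict[OF assms(3,4)] using assms
  by (simp add: chain_partial_def chain_differentiable_def)

lemma chain_partial_cmult:
  assumes "chain_differentiable j f" "x \<in> chain_space j" "a \<in> chain_indices j"
  shows "chain_partial a (\<lambda>x\<in>chain_space j. c * f x) x = c * chain_partial a f x"
  unfolding chain_partial_restrict[OF assms(2,3)] using assms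
  by (simp add: chain_partial_def chain_differentiable_def)

text \<open>The invariant for the induction over the function algebra. Membership of the partial
  derivatives alone is not inductive: the product rule also needs differentiability and membership
  of the factors themselves.\<close>

definition chain_smooth :: "nat \<Rightarrow> ('n::finite chain \<Rightarrow> complex) \<Rightarrow> bool" where
  "chain_smooth j f \<longleftrightarrow> chain_differentiable j f \<and> restrict f (chain_space j) \<in> chain_functions j \<and>
     (\<forall>a\<in>chain_indices j. (\<lambda>x\<in>chain_space j. chain_partial a f x) \<in> chain_functions j)"

lemma chain_functions_intros:
  "(\<lambda>x\<in>chain_space j. c) \<in> chain_functions j"
  "restrict f (chain_space j) \<in> chain_functions j \<Longrightarrow> restrict g (chain_space j) \<in> chain_functions j \<Longrightarrow>
    (\<lambda>x\<in>chain_space j. f x + g x) \<in> chain_functions j"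
  "restrict f (chain_space j) \<in> chain_functions j \<Longrightarrow> restrict g (chain_space j) \<in> chain_functions j \<Longrightarrow>
    (\<lambda>x\<in>chain_space j. f x * g x) \<in> chain_functions j"
  "restrict f (chain_space j) \<in> chain_functions j \<Longrightarrow> (\<lambda>x\<in>chain_space j. - f x) \<in> chain_functions j"
  unfolding chain_functions_def
  by (fact function_algebra_const function_algebra_add function_algebra_mult function_algebra_uminus)+

lemma chain_functions_sum:
  assumes "finite A" "\<And>a. a \<in> A \<Longrightarrow> restrict (f a) (chain_space j) \<in> chain_functions j"
  shows "(\<lambda>x\<in>chain_space j. \<Sum>a\<in>A. f a x) \<in> chain_functions j"
  using assms unfolding chain_functions_def by (rule function_algebra_sum)

lemma chain_smooth_const: "chain_smooth j (\<lambda>x. c)"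
  by (simp add: chain_smooth_def chain_differentiable_def chain_partial_def chain_functions_intros)

lemma chain_smooth_coord:
  assumes "a \<in> chain_indices j"
  shows "chain_smooth j (chain_coord a)"
proof -
  have "(\<lambda>t. c + (if P then t else 0)) field_differentiable at 0" for c :: complex and P
    by (cases P) (auto intro!: field_differentiable_add field_differentiable_ident)
  with assms show ?thesis
    by (simp add: chain_smooth_def chain_differentiable_def chain_coord_in chain_partial_coord
      chain_functions_intros chain_coord_shift)
qed

lemma chain_smooth_add:
  assumes "chain_smooth j f" "chain_smooth j g"
  shows "chain_smooth j (\<lambda>x. f x + g x)"
proof -
  have "chain_partial a (\<lambda>x. f x + g x) x = chain_partial a f x + chain_partial a g x"
    if "x \<in> chain_space j" "a \<in> chain_indices j" for a x
    using chain_partial_add[OF _ _ that, of f g] assms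
    unfolding chain_partial_restrict[OF that] chain_smooth_def by blast
  then have "(\<lambda>x\<in>chain_space j. chain_partial a (\<lambda>x. f x + g x) x)
      = (\<lambda>x\<in>chain_space j. chain_partial a f x + chain_partial a g x)" if "a \<in> chain_indices j" for a
    using that by (intro restrict_ext)
  then show ?thesis using assms
    by (auto simp: chain_smooth_def chain_differentiable_def intro!: chain_functions_intros
        field_differentiable_add)
qed

lemma chain_smooth_mult:
  assumes "chain_smooth j f" "chain_smooth j g"
  shows "chain_smooth j (\<lambda>x. f x * g x)"
proof -
  have "chain_partial a (\<lambda>x. f x * g x) x = f x * chain_partial a g x + chain_partial a f x * g x"
    if "x \<in> chain_space j" "a \<in> chain_indices j" for a x
    using chain_partial_mult[OF _ _ that, of f g] assms
    unfolding chain_partial_restrict[OF that] chain_smooth_def by blast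
  then have "(\<lambda>x\<in>chain_space j. chain_partial a (\<lambda>x. f x * g x) x)
      = (\<lambda>x\<in>chain_space j. f x * chain_partial a g x + chain_partial a f x * g x)"
    if "a \<in> chain_indices j" for a
    using that by (intro restrict_ext)
  then show ?thesis using assms
    by (auto simp: chain_smooth_def chain_differentiable_def intro!: chain_functions_intros
        field_differentiable_mult)
qed

lemma chain_smooth_sum:
  "finite A \<Longrightarrow> (\<And>a. a \<in> A \<Longrightarrow> chain_smooth j (f a)) \<Longrightarrow> chain_smooth j (\<lambda>x. \<Sum>a\<in>A. f a x)"
  by (induction rule: finite_induct) (auto intro!: chain_smooth_const chain_smooth_add)

lemma chain_smooth_prod:
  "finite A \<Longrightarrow> (\<And>a. a \<in> A \<Longrightarrow> chain_smooth j (f a)) \<Longrightarrow> chain_smooth j (\<lambda>x. \<Prod>a\<in>A. f a x)"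
  by (induction rule: finite_induct) (auto intro!: chain_smooth_const chain_smooth_mult)

lemma chain_smooth_det:
  assumes "k \<in> {1..j}"
  shows "chain_smooth j (\<lambda>x. det (chain_B k x))"
proof -
  have "(\<lambda>x. chain_B k x $ a $ b) = chain_coord (k, a, b)" for a b :: 'a
    using assms by (auto simp: chain_coord_def chain_matrix_def)
  then have "chain_smooth j (\<lambda>x. chain_B k x $ a $ b)" for a b :: 'a
    using assms chain_smooth_coord[of "(k, a, b)" j] by (simp add: chain_indices_def)
  then show ?thesis
    unfolding det_def
    by (intro chain_smooth_sum chain_smooth_mult chain_smooth_prod chain_smooth_const) auto
qed

lemma chain_smooth_inverse_det:
  assumes "k \<in> {1..j}"
  shows "chain_smooth j (\<lambda>x. inverse (det (chain_B k x)))"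
proof -
  let ?d = "\<lambda>x. det (chain_B k x)" and ?i = "\<lambda>x. inverse (det (chain_B k x))"
  have nz: "?d x \<noteq> 0" if "x \<in> chain_space j" for x
  proof -
    have "chain_B k x \<in> GL" using that assms by (auto simp: chain_space_def)
    then show ?thesis by (simp add: GL_def invertible_det_nz)
  qed
  note d = chain_smooth_det[OF assms]
  have i_in: "restrict ?i (chain_space j) \<in> chain_functions j"
    unfolding chain_functions_eq using assms
    by (intro function_algebra.gen) (auto simp: chain_inverse_dets_def)
  have diff: "(\<lambda>t. ?d (chain_shift a t x)) field_differentiable at 0"
    if "x \<in> chain_space j" "a \<in> chain_indices j" for a x
    using d that by (auto simp: chain_smooth_def chain_differentiable_def)
  \<comment> \<open>The derivative -d'/d^2 is written with two factors 1/d, which are generators, so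
    that it visibly lies in the algebra.\<close>
  have "chain_partial a ?i x = - (chain_partial a ?d x * (?i x * ?i x))"
    if "x \<in> chain_space j" "a \<in> chain_indices j" for a x
    using diff[OF that] nz[OF that(1)]
    by (simp add: chain_partial_def power2_eq_square divide_inverse)
  then have *: "(\<lambda>x\<in>chain_space j. chain_partial a ?i x)
      = (\<lambda>x\<in>chain_space j. - (chain_partial a ?d x * (?i x * ?i x)))" if "a \<in> chain_indices j" for a
    using that by (intro restrict_ext)
  show ?thesis
    unfolding chain_smooth_def
  proof (intro conjI ballI)
    show "chain_differentiable j ?i"
      unfolding chain_differentiable_def
      by (intro ballI field_differentiable_inverse diff) (simp_all add: nz)
    show "(\<lambda>x\<in>chain_space j. chain_partial a ?i x) \<in> chain_functions j" if "a \<in> chain_indices j" for a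
      unfolding *[OF that] using that d i_in
      by (intro chain_functions_intros) (auto simp: chain_smooth_def)
  qed (fact i_in)
qed

lemma chain_smooth_restrict:
  assumes "chain_smooth j f"
  shows "chain_smooth j (restrict f (chain_space j))"
proof -
  have "(\<lambda>x\<in>chain_space j. chain_partial a (restrict f (chain_space j)) x)
      = (\<lambda>x\<in>chain_space j. chain_partial a f x)" if "a \<in> chain_indices j" for a
    using that by (intro restrict_ext chain_partial_restrict)
  then show ?thesis
    using assms by (auto simp: chain_smooth_def intro: chain_differentiable_restrict)
qed

lemma chain_functions_smooth: "f \<in> chain_functions j \<Longrightarrow> chain_smooth j f"
  unfolding chain_functions_eq
proof (induction rule: function_algebra.induct)
  case (gen g)
  then show ?case
    by (auto intro!: chain_smooth_restrict intro: chain_smooth_coord chain_smooth_inverse_det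
        simp: chain_inverse_dets_def)
qed (auto intro!: chain_smooth_restrict intro: chain_smooth_const chain_smooth_add chain_smooth_mult)

lemma chain_partial_in:
  "f \<in> chain_functions j \<Longrightarrow> a \<in> chain_indices j \<Longrightarrow>
    (\<lambda>x\<in>chain_space j. chain_partial a f x) \<in> chain_functions j"
  using chain_functions_smooth by (auto simp: chain_smooth_def)

lemma chain_partial_derivation:
  assumes "x \<in> chain_space j" "a \<in> chain_indices j"
  shows "derivation_at (chain_space j) (chain_functions j) x (\<lambda>f. chain_partial a f x)"
proof -
  have d: "chain_differentiable j f" if "f \<in> chain_functions j" for f
    using chain_functions_smooth[OF that] by (simp add: chain_smooth_def)
  have d': "chain_differentiable j (\<lambda>y. c * f y)" if "f \<in> chain_functions j" for f c
    using d[OF that] by (auto simp: chain_differentiable_def intro!: field_differentiable_mult)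
  show ?thesis
    unfolding derivation_at_def
    using chain_partial_mult[OF d d assms] chain_partial_add[OF d' d assms]
      chain_partial_cmult[OF d assms, unfolded chain_partial_restrict[OF assms]] by simp
qed

section \<open>The bracket on chains as a bivector field, and its Jacobi identity\<close>

definition chain_structure ::
  "(nat \<Rightarrow> 'n::{finite,linorder} tensor) \<Rightarrow> nat \<times> 'n \<times> 'n \<Rightarrow> nat \<times> 'n \<times> 'n \<Rightarrow> 'n chain \<Rightarrow> complex" where
  "chain_structure Q = (\<lambda>(k, i, i') (l, m, m') x.
     exchange (chain_coeff Q) k l (chain_matrix k x) (chain_matrix l x) i i' m m')"

text \<open>The bivector field with components \<open>chain_structure\<close> in the coordinates.
  Being first order in each argument, it is a biderivation whatever the components are; only
  skewness and the Jacobi identity depend on them. The outer restriction makes the result a member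
  of the function algebra.\<close>

definition chain_bracket ::
  "nat \<Rightarrow> (nat \<Rightarrow> 'n::{finite,linorder} tensor) \<Rightarrow> 'n chain bracket" where
  "chain_bracket j Q f g = (\<lambda>x\<in>chain_space j. \<Sum>a\<in>chain_indices j. \<Sum>b\<in>chain_indices j.
     chain_structure Q a b x * (chain_partial a f x * chain_partial b g x))"

lemma chain_structure_in:
  assumes "a \<in> chain_indices j" "b \<in> chain_indices j"
  shows "restrict (chain_structure Q a b) (chain_space j) \<in> chain_functions j"
  using assms
  by (auto simp: chain_structure_def exchange_def chain_indices_def
      intro!: chain_functions_intros chain_matrix_in)

lemma chain_structure_skew: "chain_structure Q a b x = - chain_structure Q b a x"
  unfolding chain_structure_def split_def by (rule exchange_skew) (rule chain_coeff_skew)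

lemma chain_bracket_in:
  assumes "f \<in> chain_functions j" "g \<in> chain_functions j"
  shows "chain_bracket j Q f g \<in> chain_functions j"
  unfolding chain_bracket_def
  by (intro chain_functions_sum chain_functions_intros finite_chain_indices chain_structure_in
      chain_partial_in assms)

lemma chain_bracket_skew:
  assumes "x \<in> chain_space j"
  shows "chain_bracket j Q f g x = - chain_bracket j Q g f x"
proof -
  have "chain_bracket j Q f g x = (\<Sum>b\<in>chain_indices j. \<Sum>a\<in>chain_indices j.
     chain_structure Q a b x * (chain_partial a f x * chain_partial b g x))"
    unfolding chain_bracket_def restrict_apply'[OF assms] by (rule sum.swap)
  also have "\<dots> = - chain_bracket j Q g f x"
    unfolding chain_bracket_def restrict_apply'[OF assms] sum_negf[symmetric]
    by (intro sum.cong refl) (subst chain_structure_skew, simp)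
  finally show ?thesis .
qed

lemma chain_bracket_derivation_left:
  assumes "x \<in> chain_space j"
  shows "derivation_at (chain_space j) (chain_functions j) x (\<lambda>f. chain_bracket j Q f h x)"
proof -
  have d: "chain_partial a (\<lambda>y\<in>chain_space j. c * f y + g y) x
      = c * chain_partial a f x + chain_partial a g x"
    "chain_partial a (\<lambda>y\<in>chain_space j. f y * g y) x
      = f x * chain_partial a g x + chain_partial a f x * g x"
    if "a \<in> chain_indices j" "f \<in> chain_functions j" "g \<in> chain_functions j" for a f g c
    using chain_partial_derivation[OF assms that(1)] that(2,3) unfolding derivation_at_def by blast+
  show ?thesis
    unfolding derivation_at_def chain_bracket_def restrict_apply'[OF assms]
    by (simp add: d cong: sum.cong)
      (simp add: sum_distrib_left sum_distrib_right sum.distrib[symmetric] algebra_simps)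
qed

lemma chain_bracket_derivation_right:
  assumes "x \<in> chain_space j"
  shows "derivation_at (chain_space j) (chain_functions j) x (\<lambda>g. chain_bracket j Q f g x)"
  using chain_bracket_derivation_left[OF assms, of Q f]
  unfolding derivation_at_def chain_bracket_skew[OF assms, of Q f] by (simp add: algebra_simps)

lemma chain_bracket_coord:
  fixes Q :: "nat \<Rightarrow> 'n::{finite,linorder} tensor"
  assumes "a \<in> chain_indices j" "b \<in> chain_indices j"
  shows "chain_bracket j Q (restrict (chain_coord a) (chain_space j)) (restrict (chain_coord b) (chain_space j))
     = restrict (chain_structure Q a b) (chain_space j)"
  unfolding chain_bracket_def
proof (rule restrict_ext)
  fix x :: "'n chain" assume x: "x \<in> chain_space j"
  have "(\<Sum>a'\<in>chain_indices j. \<Sum>b'\<in>chain_indices j. chain_structure Q a' b' x *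
          (chain_partial a' (restrict (chain_coord a) (chain_space j)) x *
           chain_partial b' (restrict (chain_coord b) (chain_space j)) x))
      = (\<Sum>a'\<in>chain_indices j. \<Sum>b'\<in>chain_indices j.
          if b' = b then (if a' = a then chain_structure Q a b x else 0) else 0)"
    by (intro sum.cong refl) (simp add: chain_partial_restrict[OF x] chain_partial_coord)
  also have "\<dots> = chain_structure Q a b x"
    using assms by simp
  finally show "(\<Sum>a'\<in>chain_indices j. \<Sum>b'\<in>chain_indices j. chain_structure Q a' b' x *
          (chain_partial a' (restrict (chain_coord a) (chain_space j)) x *
           chain_partial b' (restrict (chain_coord b) (chain_space j)) x)) = chain_structure Q a b x" .
qed

text \<open>The structure functions are quadratic in the entries, so Leibniz expresses a derivation
  of them by its values on entries. With the bracket against a coordinate as \<delta>, the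
  right-hand side becomes \<open>exchange2\<close>.\<close>

lemma derivation_at_exchange:
  fixes x :: "'n::finite chain"
  defines "M \<equiv> chain_matrix"
  assumes x: "x \<in> chain_space j" and \<delta>: "derivation_at (chain_space j) (chain_functions j) x \<delta>"
    and le: "l \<le> j" "m \<le> j"
  defines "D \<equiv> \<lambda>p a b. \<delta> (\<lambda>y\<in>chain_space j. M p y $ a $ b)"
  shows "\<delta> (\<lambda>y\<in>chain_space j. exchange c l m (M l y) (M m y) i i' k k')
     = c (l, False) (m, False) i k * (D l k i' * M m x $ i $ k' + M l x $ k $ i' * D m i k')
     + c (l, False) (m, True) i k' * (D l k' i' * M m x $ k $ i + M l x $ k' $ i' * D m k i)
     + c (l, True) (m, False) i' k * (D l i k * M m x $ i' $ k' + M l x $ i $ k * D m i' k')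
     + c (l, True) (m, True) i' k' * (D l i k' * M m x $ k $ i' + M l x $ i $ k' * D m k i')"
proof -
  have mem: "(\<lambda>y\<in>chain_space j. M p y $ a $ b) \<in> chain_functions j" if "p \<le> j" for p a b
    using that unfolding M_def by (rule chain_matrix_in)
  have cmult: "\<delta> (\<lambda>y\<in>chain_space j. u * M l y $ a $ b) = u * D l a b" for u a b
    unfolding D_def using \<delta> x mem[OF le(1)] unfolding chain_functions_def
    by (rule derivation_at_cmult)
  have monomial: "\<delta> (\<lambda>y\<in>chain_space j. u * M l y $ a $ b * M m y $ d $ e)
      = u * (D l a b * M m x $ d $ e + M l x $ a $ b * D m d e)" for u a b d e
    using derivation_at_times[OF \<delta> x, of "\<lambda>y. u * M l y $ a $ b" "\<lambda>y. M m y $ d $ e"] mem le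
    unfolding cmult by (simp add: D_def chain_functions_intros algebra_simps)
  show ?thesis
    unfolding exchange_def monomial[symmetric]
    by (subst derivation_at_plus[OF \<delta>]; (intro chain_functions_intros mem le)?)+ simp
qed

lemma chain_bracket_exchange2:
  fixes Q :: "nat \<Rightarrow> 'a::{finite,linorder} tensor"
  assumes x: "x \<in> chain_space j" and le: "k \<le> j" "l \<le> j" "m \<le> j"
  shows "chain_bracket j Q (restrict (chain_coord (k, a, a')) (chain_space j))
      (chain_bracket j Q (restrict (chain_coord (l, b, b')) (chain_space j))
         (restrict (chain_coord (m, d, d')) (chain_space j))) x
    = exchange2 (chain_coeff Q) k l m (chain_matrix k x) (chain_matrix l x) (chain_matrix m x)
        a a' b b' d d'"
proof -
  let ?f = "restrict (chain_coord (k, a, a')) (chain_space j)"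
  have idx: "(p, r, r') \<in> chain_indices j" if "p \<le> j" for p and r r' :: 'a
    using that by (simp add: chain_indices_def)
  have D: "chain_bracket j Q ?f (\<lambda>y\<in>chain_space j. chain_matrix p y $ r $ r') x
      = exchange (chain_coeff Q) k p (chain_matrix k x) (chain_matrix p x) a a' r r'" if "p \<le> j" for p r r'
    using chain_bracket_coord[OF idx[OF le(1)] idx[OF that], of Q a a' r r'] x
    by (simp add: chain_structure_def chain_coord_def)
  show ?thesis
    unfolding chain_bracket_coord[OF idx[OF le(2)] idx[OF le(3)]]
    using derivation_at_exchange[OF x chain_bracket_derivation_right[OF x, of Q ?f] le(2,3),
        of "chain_coeff Q" b b' d d']
    by (simp add: chain_structure_def exchange2_def D le)
qed

lemma chain_bracket_poisson:
  fixes Q :: "nat \<Rightarrow> 'a::{finite,linorder} tensor"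
  shows "poisson_structure (chain_space j) (chain_functions j) (chain_bracket j Q)"
  unfolding chain_functions_eq
proof (rule poisson_structureI, unfold chain_functions_eq[symmetric])
  fix f g h :: "'a chain \<Rightarrow> complex" and x :: "'a chain"
  assume "f \<in> chain_coord ` chain_indices j" "g \<in> chain_coord ` chain_indices j"
    "h \<in> chain_coord ` chain_indices j" and x: "x \<in> chain_space j"
  then obtain k a a' l b b' m d d' where le: "k \<le> j" "l \<le> j" "m \<le> j"
    and f: "f = chain_coord (k, a, a')" and g: "g = chain_coord (l, b, b')"
    and h: "h = chain_coord (m, d, d')"
    by (auto simp: chain_indices_def)
  show "chain_bracket j Q (restrict f (chain_space j))
          (chain_bracket j Q (restrict g (chain_space j)) (restrict h (chain_space j))) x
      + chain_bracket j Q (restrict g (chain_space j))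
          (chain_bracket j Q (restrict h (chain_space j)) (restrict f (chain_space j))) x
      + chain_bracket j Q (restrict h (chain_space j))
          (chain_bracket j Q (restrict f (chain_space j)) (restrict g (chain_space j))) x = 0"
    unfolding f g h chain_bracket_exchange2[OF x le(1,2,3)] chain_bracket_exchange2[OF x le(2,3,1)]
      chain_bracket_exchange2[OF x le(3,1,2)]
  proof (rule exchange_jacobi)
    show "chain_coeff Q s t i j = - chain_coeff Q t s j i" for s t i j
      by (rule chain_coeff_skew)
    show "yang_baxter (chain_coeff Q) s t u i j k T = (if s = t \<and> t = u then T k i j - T j k i else 0)"
      for s t u i j k T
      unfolding chain_coeff_def by (rule exchange_coeff_yang_baxter[OF inj_slot])
  qed auto
qed (rule chain_bracket_in chain_bracket_skew chain_bracket_derivation_left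
    chain_inverse_dets_inverse; assumption)+

lemma tensor_bracket_chain:
  assumes x: "x \<in> chain_space j" and le: "k \<le> j" "l \<le> j"
  shows "tensor_bracket (chain_space j) (chain_bracket j Q) (chain_matrix k) (chain_matrix l) x $ (a, b) $ (a', b')
     = exchange (chain_coeff Q) k l (chain_matrix k x) (chain_matrix l x) a a' b b'"
  using chain_bracket_coord[of "(k, a, a')" j "(l, b, b')" Q] x le
  by (simp add: tensor_bracket_def chain_indices_def chain_structure_def chain_coord_def)

lemma chain_bracket_formulas:
  fixes Q :: "nat \<Rightarrow> 'a::{finite,linorder} tensor"
  assumes Q: "\<And>k. k < j \<Longrightarrow> Q k \<in> Q_types" and "j \<ge> 1"
  shows "chain_formulas j Q (chain_bracket j Q)"
proof -
  have M: "chain_matrix 0 = (fst :: 'a chain \<Rightarrow> _)" "\<And>k. k \<noteq> 0 \<Longrightarrow> chain_matrix k = (chain_B k :: 'a chain \<Rightarrow> _)"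
    by (auto simp: chain_matrix_def)
  have "tensor_bracket (chain_space j) (chain_bracket j Q) fst fst x = AA_rhs (fst x)"
    if "x \<in> chain_space j" for x
    using tensor_bracket_chain[OF that, of 0 0 Q] by (simp add: vec_eq_iff M exchange_AA)
  moreover have "tensor_bracket (chain_space j) (chain_bracket j Q) (chain_B 1) fst x
      = BA_rhs (Q 0) (chain_B 1 x) (fst x)" if "x \<in> chain_space j" for x
    using tensor_bracket_chain[OF that, of 1 0 Q] assms
    by (simp add: vec_eq_iff M exchange_BA[unfolded One_nat_def])
  moreover have "tensor_bracket (chain_space j) (chain_bracket j Q) (chain_B k) fst x = 0"
    if "x \<in> chain_space j" "k \<in> {2..j}" for x k
    using tensor_bracket_chain[OF that(1), of k 0 Q] that(2)
    by (simp add: vec_eq_iff M exchange_zero)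
  moreover have "tensor_bracket (chain_space j) (chain_bracket j Q) (chain_B k) (chain_B k) x
      = BB_rhs (chain_B k x)" if "x \<in> chain_space j" "k \<in> {1..j}" for x k
    using tensor_bracket_chain[OF that(1), of k k Q] that(2)
    by (simp add: vec_eq_iff M exchange_BB)
  moreover have "tensor_bracket (chain_space j) (chain_bracket j Q) (chain_B (k + 1)) (chain_B k) x
      = leg1 (chain_B (k + 1) x) ** Q k ** leg2 (chain_B k x)"
    if "x \<in> chain_space j" "k \<in> {1..<j}" for x k
    using tensor_bracket_chain[OF that(1), of "k + 1" k Q] that(2) exchange_B_Suc_B[of Q k] Q
    by (simp add: vec_eq_iff M)
  moreover have "tensor_bracket (chain_space j) (chain_bracket j Q) (chain_B k) (chain_B l) x = 0"
    if "x \<in> chain_space j" "k \<in> {1..j}" "l \<in> {1..j}" "\<bar>int k - int l\<bar> > 1" for x k l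
  proof -
    have "exchange (chain_coeff Q) k l X Y i i' m m' = 0" for X Y i i' m m'
    proof (cases "l + 1 < k")
      case True
      then show ?thesis by (rule exchange_zero)
    next
      case False
      then have "k + 1 < l" using that(4) by auto
      then show ?thesis
        using exchange_skew[of "chain_coeff Q" k l, OF chain_coeff_skew] by (simp add: exchange_zero)
    qed
    then show ?thesis
      using tensor_bracket_chain[OF that(1), of k l Q] that(2,3) by (simp add: vec_eq_iff M)
  qed
  ultimately show ?thesis
    unfolding chain_formulas_def by blast
qed

section \<open>Brackets of products of matrices\<close>

text \<open>Fixing the evaluation point makes the bracket a number-valued skew biderivation
  \<open>pb\<close> on unrestricted functions. This keeps restrictions and the point out of the
  matrix computations; \<open>regular\<close> records membership in the algebra.\<close>

locale chain_point =
  fixes j :: nat and Q :: "nat \<Rightarrow> 'n::{finite,linorder} tensor" and x :: "'n chain"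
  assumes x: "x \<in> chain_space j"
begin

definition pb :: "('n chain \<Rightarrow> complex) \<Rightarrow> ('n chain \<Rightarrow> complex) \<Rightarrow> complex" where
  "pb f g = chain_bracket j Q (restrict f (chain_space j)) (restrict g (chain_space j)) x"

definition regular :: "('n chain \<Rightarrow> complex) \<Rightarrow> bool" where
  "regular f \<longleftrightarrow> restrict f (chain_space j) \<in> chain_functions j"

definition regular_matrix :: "('n chain \<Rightarrow> 'n cmatrix) \<Rightarrow> bool" where
  "regular_matrix X \<longleftrightarrow> (\<forall>a b. regular (\<lambda>y. X y $ a $ b))"

lemma regular_mult: "regular f \<Longrightarrow> regular g \<Longrightarrow> regular (\<lambda>y. f y * g y)"
  unfolding regular_def by (rule chain_functions_intros)

lemma regular_sum: "finite A \<Longrightarrow> (\<And>a. a \<in> A \<Longrightarrow> regular (f a)) \<Longrightarrow> regular (\<lambda>y. \<Sum>a\<in>A. f a y)"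
  unfolding regular_def by (rule chain_functions_sum)

lemma regular_const: "regular (\<lambda>y. c)"
  unfolding regular_def by (rule chain_functions_intros)

lemma regular_entry: "regular_matrix X \<Longrightarrow> regular (\<lambda>y. X y $ a $ b)"
  by (simp add: regular_matrix_def)

lemma pb_skew: "pb f g = - pb g f"
  unfolding pb_def using x by (rule chain_bracket_skew)

lemma pb_mult_left: "regular f \<Longrightarrow> regular g \<Longrightarrow> pb (\<lambda>y. f y * g y) h = f x * pb g h + pb f h * g x"
  unfolding pb_def regular_def
  by (rule derivation_at_times[OF chain_bracket_derivation_left[OF x] x])

lemma pb_mult_right: "regular f \<Longrightarrow> regular g \<Longrightarrow> pb h (\<lambda>y. f y * g y) = f x * pb h g + pb h f * g x"
  unfolding pb_def regular_def
  by (rule derivation_at_times[OF chain_bracket_derivation_right[OF x] x])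

lemma pb_sum_left:
  "finite A \<Longrightarrow> (\<And>a. a \<in> A \<Longrightarrow> regular (f a)) \<Longrightarrow> pb (\<lambda>y. \<Sum>a\<in>A. f a y) h = (\<Sum>a\<in>A. pb (f a) h)"
  unfolding pb_def regular_def chain_functions_def
  by (rule derivation_at_sum[OF chain_bracket_derivation_left[OF x, unfolded chain_functions_def] x])

lemma pb_sum_right:
  "finite A \<Longrightarrow> (\<And>a. a \<in> A \<Longrightarrow> regular (f a)) \<Longrightarrow> pb h (\<lambda>y. \<Sum>a\<in>A. f a y) = (\<Sum>a\<in>A. pb h (f a))"
  unfolding pb_def regular_def chain_functions_def
  by (rule derivation_at_sum[OF chain_bracket_derivation_right[OF x, unfolded chain_functions_def] x])

lemma pb_const_right: "pb h (\<lambda>y. c) = 0"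
  unfolding pb_def
  by (rule derivation_at_const[OF chain_bracket_derivation_right[OF x, unfolded chain_functions_def] x])

lemma regular_chain_matrix: "k \<le> j \<Longrightarrow> regular_matrix (chain_matrix k)"
  by (simp add: regular_matrix_def regular_def chain_matrix_in)

lemma pb_chain_matrix:
  assumes "k \<le> j" "l \<le> j"
  shows "pb (\<lambda>y. chain_matrix k y $ a $ a') (\<lambda>y. chain_matrix l y $ b $ b')
     = exchange (chain_coeff Q) k l (chain_matrix k x) (chain_matrix l x) a a' b b'"
  using chain_bracket_coord[of "(k, a, a')" j "(l, b, b')" Q] x assms
  by (simp add: pb_def chain_indices_def chain_structure_def chain_coord_def)

lemma pb_matrix_mult_left:
  assumes "regular_matrix X" "regular_matrix Y"
  shows "pb (\<lambda>y. (X y ** Y y) $ a $ b) h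
     = (\<Sum>p\<in>UNIV. X x $ a $ p * pb (\<lambda>y. Y y $ p $ b) h + pb (\<lambda>y. X y $ a $ p) h * Y x $ p $ b)"
  unfolding matrix_matrix_mult_def vec_lambda_beta
  using assms by (simp add: pb_sum_left pb_mult_left regular_mult regular_entry)

lemma pb_matrix_mult_right:
  assumes "regular_matrix X" "regular_matrix Y"
  shows "pb h (\<lambda>y. (X y ** Y y) $ a $ b)
     = (\<Sum>p\<in>UNIV. X x $ a $ p * pb h (\<lambda>y. Y y $ p $ b) + pb h (\<lambda>y. X y $ a $ p) * Y x $ p $ b)"
  unfolding matrix_matrix_mult_def vec_lambda_beta
  using assms by (simp add: pb_sum_right pb_mult_right regular_mult regular_entry)

lemma regular_matrix_mult:
  assumes "regular_matrix X" "regular_matrix Y"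
  shows "regular_matrix (\<lambda>y. X y ** Y y)"
  using assms unfolding regular_matrix_def matrix_matrix_mult_def vec_lambda_beta
  by (intro allI regular_sum regular_mult) auto

lemma regular_matrix_transpose: "regular_matrix X \<Longrightarrow> regular_matrix (\<lambda>y. transpose (X y))"
  by (simp add: regular_matrix_def transpose_def)

end

lemma sum_sum_antisym:
  fixes f :: "'n::finite \<Rightarrow> 'n \<Rightarrow> complex"
  assumes "\<And>p q. f p q = - f q p"
  shows "(\<Sum>p\<in>UNIV. \<Sum>q\<in>UNIV. f p q) = 0"
proof -
  have "(\<Sum>p\<in>UNIV. \<Sum>q\<in>UNIV. f p q) = (\<Sum>q\<in>UNIV. \<Sum>p\<in>UNIV. f p q)" by (rule sum.swap)
  also have "\<dots> = (\<Sum>q\<in>UNIV. \<Sum>p\<in>UNIV. - f q p)"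
    using assms by (intro sum.cong refl)
  finally show ?thesis by (simp add: sum_negf)
qed

lemma sum_quad_tuple:
  fixes f :: "'n::finite \<Rightarrow> 'n \<Rightarrow> 'n \<Rightarrow> 'n \<Rightarrow> complex"
  shows "(\<Sum>p\<in>UNIV. \<Sum>q\<in>UNIV. \<Sum>p'\<in>UNIV. \<Sum>q'\<in>UNIV. f p q p' q') = (\<Sum>(p, q, p', q')\<in>UNIV. f p q p' q')"
  by (simp add: sum_UNIV_prod)

text \<open>Intended for fourfold sums, where \<sigma> transposes two of the four summation
  indices.\<close>

lemma sum_antisym:
  fixes f :: "'a \<Rightarrow> complex"
  assumes "\<And>v. \<sigma> (\<sigma> v) = v" and "\<And>v. f (\<sigma> v) = - f v"
  shows "sum f UNIV = 0"
proof -
  have "sum f UNIV = sum (f \<circ> \<sigma>) UNIV"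
    by (rule sum.reindex_bij_witness[of _ \<sigma> \<sigma>]) (auto simp: assms(1))
  also have "\<dots> = - sum f UNIV"
    by (simp add: assms(2) sum_negf)
  finally show ?thesis by simp
qed

context chain_point
begin

text \<open>
  The column slot of \<open>X\<close> and the row slot of \<open>Y\<close> are contracted in \<open>X Y\<close>; the terms in which they
  take part are antisymmetric under the exchange of the two contracted indices.
\<close>

lemma pb_product:
  assumes reg: "regular_matrix X" "regular_matrix Y"
    and XX: "\<And>a b a' b'. pb (\<lambda>y. X y $ a $ a') (\<lambda>y. X y $ b $ b') = BB_rhs (X x) $ (a, b) $ (a', b')"
    and YY: "\<And>a b a' b'. pb (\<lambda>y. Y y $ a $ a') (\<lambda>y. Y y $ b $ b') = BB_rhs (Y x) $ (a, b) $ (a', b')"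
    and XY: "\<And>a b a' b'. pb (\<lambda>y. X y $ a $ a') (\<lambda>y. Y y $ b $ b') = c a' b * X x $ a $ b * Y x $ a' $ b'"
  shows "pb (\<lambda>y. (X y ** Y y) $ a $ a') (\<lambda>y. (X y ** Y y) $ b $ b') = BB_rhs (X x ** Y x) $ (a, b) $ (a', b')"
proof -
  have YX: "pb (\<lambda>y. Y y $ b $ b') (\<lambda>y. X y $ a $ a') = - (c a' b * X x $ a $ b * Y x $ a' $ b')" for a b a' b'
    by (subst pb_skew) (simp only: XY)
  let ?X = "\<lambda>a b. X x $ a $ b" and ?Y = "\<lambda>a b. Y x $ a $ b"
  \<comment> \<open>\<open>D\<close> collects the coefficients at the contracted indices
    \<open>p\<close> and \<open>q\<close>, \<open>G\<close> those at the outer indices. No symmetry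
    of \<open>c\<close> is needed in \<open>D\<close>: the terms from \<open>XY\<close> and
    \<open>YX\<close> are interchanged by swapping \<open>p\<close> and \<open>q\<close>, with
    opposite sign.\<close>
  define D where "D p q = sg p q * (?X a q * ?X b p * ?Y p a' * ?Y q b' + ?X a p * ?X b q * ?Y p b' * ?Y q a')
      + c p q * ?X a q * ?X b q * ?Y p a' * ?Y p b' - c q p * ?X a p * ?X b p * ?Y q a' * ?Y q b'" for p q
  define G where "G p q = sg a b * ((?X a q * ?Y q b') * (?X b p * ?Y p a'))
      + sg a' b' * ((?X a p * ?Y p b') * (?X b q * ?Y q a'))" for p q
  have "pb (\<lambda>y. (X y ** Y y) $ a $ a') (\<lambda>y. (X y ** Y y) $ b $ b')
     = (\<Sum>p\<in>UNIV. \<Sum>q\<in>UNIV. D p q + G p q)"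
    unfolding pb_matrix_mult_left[OF reg] pb_matrix_mult_right[OF reg] XX XY YX YY BB_rhs_nth
    unfolding sum_distrib_left sum_distrib_right sum.distrib[symmetric]
    by (intro sum.cong refl) (simp add: D_def G_def algebra_simps)
  also have "\<dots> = (\<Sum>p\<in>UNIV. \<Sum>q\<in>UNIV. D p q) + (\<Sum>p\<in>UNIV. \<Sum>q\<in>UNIV. G p q)"
    by (simp add: sum.distrib)
  also have "(\<Sum>p\<in>UNIV. \<Sum>q\<in>UNIV. D p q) = 0"
  proof (rule sum_sum_antisym)
    show "D p q = - D q p" for p q
      unfolding D_def sg_skew[of p q] by (simp add: algebra_simps)
  qed
  also have "(\<Sum>p\<in>UNIV. \<Sum>q\<in>UNIV. G p q) = BB_rhs (X x ** Y x) $ (a, b) $ (a', b')"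
  proof -
    have "(\<Sum>p\<in>UNIV. \<Sum>q\<in>UNIV. (?X a q * ?Y q b') * (?X b p * ?Y p a'))
        = (X x ** Y x) $ a $ b' * (X x ** Y x) $ b $ a'"
      by (subst sum.swap) (simp add: matrix_matrix_mult_def sum_product)
    moreover have "(\<Sum>p\<in>UNIV. \<Sum>q\<in>UNIV. (?X a p * ?Y p b') * (?X b q * ?Y q a'))
        = (X x ** Y x) $ a $ b' * (X x ** Y x) $ b $ a'"
      by (simp add: matrix_matrix_mult_def sum_product)
    ultimately show ?thesis
      unfolding BB_rhs_nth G_def sum.distrib sum_distrib_left[symmetric] by (simp add: algebra_simps)
  qed
  finally show ?thesis by simp
qed

section \<open>Brackets of the congruence X T X^T\<close>

lemma congruence_nth:
  "(X ** T ** transpose X) $ a $ b = (\<Sum>p\<in>UNIV. \<Sum>q\<in>UNIV. X $ a $ p * T $ p $ q * X $ b $ q)"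
  for X T :: "'n cmatrix"
  by (simp add: matrix_matrix_mult_def transpose_def sum_distrib_right) (rule sum.swap)

lemma congruence_mult_congruence:
  fixes X T :: "'n cmatrix"
  shows "(X ** T ** transpose X) $ a $ b * (X ** T ** transpose X) $ d $ e
    = (\<Sum>(p, q, p', q')\<in>UNIV. (X $ a $ p * T $ p $ q * X $ b $ q) * (X $ d $ p' * T $ p' $ q' * X $ e $ q'))"
  unfolding congruence_nth sum_quad_tuple[symmetric] sum_distrib_right
  unfolding sum_distrib_left ..

lemma pb_congruence_left:
  assumes "regular_matrix X" "regular_matrix T"
  shows "pb (\<lambda>y. (X y ** T y ** transpose (X y)) $ a $ b) h
    = (\<Sum>p\<in>UNIV. \<Sum>q\<in>UNIV.
        pb (\<lambda>y. X y $ a $ p) h * T x $ p $ q * X x $ b $ q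
      + X x $ a $ p * pb (\<lambda>y. T y $ p $ q) h * X x $ b $ q
      + X x $ a $ p * T x $ p $ q * pb (\<lambda>y. X y $ b $ q) h)"
  unfolding congruence_nth
  using assms
  by (simp add: pb_sum_left pb_mult_left regular_mult regular_sum regular_entry algebra_simps)

lemma pb_congruence_right:
  assumes "regular_matrix X" "regular_matrix T"
  shows "pb h (\<lambda>y. (X y ** T y ** transpose (X y)) $ a $ b)
    = (\<Sum>p\<in>UNIV. \<Sum>q\<in>UNIV.
        pb h (\<lambda>y. X y $ a $ p) * T x $ p $ q * X x $ b $ q
      + X x $ a $ p * pb h (\<lambda>y. T y $ p $ q) * X x $ b $ q
      + X x $ a $ p * T x $ p $ q * pb h (\<lambda>y. X y $ b $ q))"
  unfolding congruence_nth
  using assms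
  by (simp add: pb_sum_right pb_mult_right regular_mult regular_sum regular_entry algebra_simps)

text \<open>Both slots of X T X^T are row slots of X, whose mutual coefficient is a bare sign. The
  +1 and -1 that place the column of a form above its row are inherited from T.\<close>

lemma pb_congruence:
  assumes reg: "regular_matrix X" "regular_matrix T"
    and XX: "\<And>a b a' b'. pb (\<lambda>y. X y $ a $ a') (\<lambda>y. X y $ b $ b') = BB_rhs (X x) $ (a, b) $ (a', b')"
    and TT: "\<And>a b a' b'. pb (\<lambda>y. T y $ a $ a') (\<lambda>y. T y $ b $ b') = AA_rhs (T x) $ (a, b) $ (a', b')"
    and XT: "\<And>a b a' b'. pb (\<lambda>y. X y $ a $ a') (\<lambda>y. T y $ b $ b')
      = c a' b * X x $ a $ b * T x $ a' $ b' + c a' b' * X x $ a $ b' * T x $ b $ a'"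
  shows "pb (\<lambda>y. (X y ** T y ** transpose (X y)) $ i $ m) (\<lambda>y. (X y ** T y ** transpose (X y)) $ k $ l)
     = AA_rhs (X x ** T x ** transpose (X x)) $ (i, k) $ (m, l)"
proof -
  have TX: "pb (\<lambda>y. T y $ b $ b') (\<lambda>y. X y $ a $ a')
      = - (c a' b * X x $ a $ b * T x $ a' $ b' + c a' b' * X x $ a $ b' * T x $ b $ a')" for a b a' b'
    by (subst pb_skew) (simp only: XT)
  let ?X = "\<lambda>a b. X x $ a $ b" and ?T = "\<lambda>a b. T x $ a $ b"
  \<comment> \<open>The contracted indices are \<open>p\<close>, \<open>q\<close> in the first
    argument and \<open>p'\<close>, \<open>q'\<close> in the second. \<open>D1\<close> to
    \<open>D4\<close> collect the coefficients at the four pairs formed by one of the first and one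
    of the second; each is odd under transposing its pair. \<open>R\<close> holds the constants +1
    and -1 from the bracket of \<open>T\<close>, and \<open>R1\<close> the signs between outer
    indices.\<close>
  define D1 where "D1 = (\<lambda>(p, q, p', q').
      (sg p p' * (?X i p' * ?X k p * ?T p q * ?T p' q' + ?X i p * ?X k p' * ?T p' q * ?T p q')
      + c p p' * ?X i p' * ?X k p' * ?T p q * ?T p q' - c p' p * ?X i p * ?X k p * ?T p' q * ?T p' q')
      * ?X m q * ?X l q')"
  define D2 where "D2 = (\<lambda>(p, q, p', q').
      (sg p q' * (?X i q' * ?X l p * ?T p q * ?T p' q' + ?X i p * ?X l q' * ?T p' p * ?T q' q)
      + c p q' * ?X i q' * ?X l q' * ?T p' p * ?T p q - c q' p * ?X i p * ?X l p * ?T q' q * ?T p' q')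
      * ?X m q * ?X k p')"
  define D3 where "D3 = (\<lambda>(p, q, p', q').
      (sg q p' * (?X m p' * ?X k q * ?T p q * ?T p' q' + ?X m q * ?X k p' * ?T p p' * ?T q q')
      + c q p' * ?X m p' * ?X k p' * ?T q q' * ?T p q - c p' q * ?X m q * ?X k q * ?T p p' * ?T p' q')
      * ?X i p * ?X l q')"
  define D4 where "D4 = (\<lambda>(p, q, p', q').
      (sg q q' * (?X m q' * ?X l q * ?T p q * ?T p' q' + ?X m q * ?X l q' * ?T p q' * ?T p' q)
      + c q q' * ?X m q' * ?X l q' * ?T p' q * ?T p q - c q' q * ?X m q * ?X l q * ?T p q' * ?T p' q')
      * ?X i p * ?X k p')"
  define P where "P a b d e = (\<lambda>(p, q, p', q').
      (?X a p * ?T p q * ?X b q) * (?X d p' * ?T p' q' * ?X e q'))" for a b d e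
  define R where "R = (\<lambda>(p, q, p', q').
      (?X i p * ?T p p' * ?X k p') * (?X m q * ?T q q' * ?X l q')
      - (?X k p' * ?T p' p * ?X i p) * (?X l q' * ?T q' q * ?X m q))"
  define R1 where "R1 = (\<lambda>(p, q, p', q').
      sg i k * P k m i l (p, q, p', q') + sg m l * ((?X i p * ?T p q * ?X l q) * (?X k p' * ?T p' q' * ?X m q'))
      + sg m k * ((?X i p * ?T p q * ?X k q) * (?X m p' * ?T p' q' * ?X l q'))
      + sg i l * ((?X l p * ?T p q * ?X m q) * (?X k p' * ?T p' q' * ?X i q')))"
  let ?M = "X x ** T x ** transpose (X x)"
  have "pb (\<lambda>y. (X y ** T y ** transpose (X y)) $ i $ m) (\<lambda>y. (X y ** T y ** transpose (X y)) $ k $ l)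
     = (\<Sum>(p, q, p', q')\<in>UNIV. D1 (p, q, p', q') + D2 (p, q, p', q') + D3 (p, q, p', q') + D4 (p, q, p', q')
         + R (p, q, p', q') + R1 (p, q, p', q'))"
    unfolding pb_congruence_left[OF reg] pb_congruence_right[OF reg] XX XT TX TT BB_rhs_nth AA_rhs_nth
    unfolding sum_quad_tuple[symmetric] sum_distrib_left sum_distrib_right sum.distrib[symmetric]
    by (intro sum.cong refl)
      (simp add: D1_def D2_def D3_def D4_def R_def R1_def P_def algebra_simps)
  also have "\<dots> = sum D1 UNIV + sum D2 UNIV + sum D3 UNIV + sum D4 UNIV + sum R UNIV + sum R1 UNIV"
    by (simp add: split_def sum.distrib)
  also have "sum D1 UNIV = 0"
  proof (rule sum_antisym)
    show "D1 ((\<lambda>(p, q, p', q'). (p', q, p, q')) v) = - D1 v" for v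
    proof (cases v)
      case (fields p q p' q')
      show ?thesis unfolding fields by (simp add: D1_def sg_skew[of p' p] algebra_simps)
    qed
  qed auto
  also have "sum D2 UNIV = 0"
  proof (rule sum_antisym)
    show "D2 ((\<lambda>(p, q, p', q'). (q', q, p', p)) v) = - D2 v" for v
    proof (cases v)
      case (fields p q p' q')
      show ?thesis unfolding fields by (simp add: D2_def sg_skew[of q' p] algebra_simps)
    qed
  qed auto
  also have "sum D3 UNIV = 0"
  proof (rule sum_antisym)
    show "D3 ((\<lambda>(p, q, p', q'). (p, p', q, q')) v) = - D3 v" for v
    proof (cases v)
      case (fields p q p' q')
      show ?thesis unfolding fields by (simp add: D3_def sg_skew[of p' q] algebra_simps)
    qed
  qed auto
  also have "sum D4 UNIV = 0"
  proof (rule sum_antisym)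
    show "D4 ((\<lambda>(p, q, p', q'). (p, q', p', q)) v) = - D4 v" for v
    proof (cases v)
      case (fields p q p' q')
      show ?thesis unfolding fields by (simp add: D4_def sg_skew[of q' q] algebra_simps)
    qed
  qed auto
  also have "sum R UNIV = ?M $ i $ k * ?M $ m $ l - ?M $ k $ i * ?M $ l $ m"
  proof -
    have "(\<Sum>(p, q, p', q')\<in>UNIV. (?X i p * ?T p p' * ?X k p') * (?X m q * ?T q q' * ?X l q'))
        = sum (P i k m l) UNIV"
      by (rule sum.reindex_bij_witness[of _ "\<lambda>(p, q, p', q'). (p, p', q, q')" "\<lambda>(p, q, p', q'). (p, p', q, q')"])
        (auto simp: P_def)
    moreover have "(\<Sum>(p, q, p', q')\<in>UNIV. (?X k p' * ?T p' p * ?X i p) * (?X l q' * ?T q' q * ?X m q))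
        = sum (P k i l m) UNIV"
      \<comment> \<open>The regrouping is a cyclic permutation of the four indices here, not an
        involution, hence two different witnesses.\<close>
      by (rule sum.reindex_bij_witness[of _ "\<lambda>(p, q, p', q'). (q, q', p, p')" "\<lambda>(p, q, p', q'). (p', p, q', q)"])
        (auto simp: P_def)
    ultimately show ?thesis
      unfolding congruence_mult_congruence R_def P_def by (simp add: split_def sum_subtractf)
  qed
  also have "sum R1 UNIV = sg i k * (?M $ k $ m * ?M $ i $ l) + sg m l * (?M $ i $ l * ?M $ k $ m)
     + sg m k * (?M $ i $ k * ?M $ m $ l) + sg i l * (?M $ l $ m * ?M $ k $ i)"
    unfolding congruence_mult_congruence R1_def P_def
    by (simp add: split_def sum.distrib sum_distrib_left)
  finally show ?thesis
    unfolding AA_rhs_nth by (simp add: algebra_simps)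
qed


section \<open>Inductions along the chain for iterated products and transformed forms\<close>

lemma regular_matrix_const: "regular_matrix (\<lambda>y. C)"
  by (simp add: regular_matrix_def regular_const)

lemma regular_chain_B: "k \<in> {1..j} \<Longrightarrow> regular_matrix (chain_B k)"
  using regular_chain_matrix[of k] by (auto simp: regular_matrix_def chain_matrix_def)

lemma regular_fst: "regular_matrix fst"
  using regular_chain_matrix[of 0] by (auto simp: regular_matrix_def chain_matrix_def)

lemma regular_iterated_product: "k \<le> j \<Longrightarrow> regular_matrix (iterated_product k)"
proof (induction k)
  case 0
  then show ?case by (simp add: regular_matrix_const)
next
  case (Suc k)
  then show ?case using regular_matrix_mult[OF regular_chain_B[of "Suc k"]] by simp
qed

lemma regular_transformed_form: "k \<le> j \<Longrightarrow> regular_matrix (transformed_form k)"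
proof (induction k)
  case 0
  then show ?case using regular_fst by simp
next
  case (Suc k)
  then have B: "regular_matrix (chain_B (Suc k))" by (intro regular_chain_B) simp
  show ?case
    using regular_matrix_mult[OF regular_matrix_mult[OF B Suc.IH] regular_matrix_transpose[OF B]] Suc
    by simp
qed

lemma pb_fst_fst:
  "pb (\<lambda>y. fst y $ a $ a') (\<lambda>y. fst y $ b $ b') = AA_rhs (fst x) $ (a, b) $ (a', b')"
  using pb_chain_matrix[of 0 0] by (simp add: chain_matrix_def exchange_AA)

lemma pb_B_B:
  assumes "k \<in> {1..j}"
  shows "pb (\<lambda>y. chain_B k y $ a $ a') (\<lambda>y. chain_B k y $ b $ b')
    = BB_rhs (chain_B k x) $ (a, b) $ (a', b')"
  using pb_chain_matrix[of k k] assms by (simp add: chain_matrix_def exchange_BB)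

lemma pb_B_B_zero:
  assumes "l \<in> {1..j}" "k \<in> {1..j}" "l + 1 < k"
  shows "pb (\<lambda>y. chain_B k y $ a $ a') (\<lambda>y. chain_B l y $ b $ b') = 0"
  using pb_chain_matrix[of k l] assms by (simp add: chain_matrix_def exchange_zero)

lemma pb_B_fst_zero:
  assumes "k \<in> {2..j}"
  shows "pb (\<lambda>y. chain_B k y $ a $ a') (\<lambda>y. fst y $ b $ b') = 0"
  using pb_chain_matrix[of k 0] assms by (simp add: chain_matrix_def exchange_zero)

lemma pb_B_fst:
  assumes "Q 0 \<in> Q_types" "j \<ge> 1"
  shows "pb (\<lambda>y. chain_B 1 y $ a $ a') (\<lambda>y. fst y $ b $ b')
    = BA_rhs (Q 0) (chain_B 1 x) (fst x) $ (a, b) $ (a', b')"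
  using pb_chain_matrix[of 1 0] exchange_BA[of Q] assms by (simp add: chain_matrix_def)

lemma pb_B_Suc_B:
  assumes "k \<in> {1..<j}" "Q k \<in> Q_types"
  shows "pb (\<lambda>y. chain_B (Suc k) y $ a $ a') (\<lambda>y. chain_B k y $ b $ b')
    = Q_coeff (Q k) a' b * chain_B (Suc k) x $ a $ b * chain_B k x $ a' $ b'"
  using pb_chain_matrix[of "Suc k" k] exchange_B_Suc_B[of Q k] assms
  by (simp add: chain_matrix_def Q_leg1_leg2_nth)

lemma pb_B_iterated_product_zero:
  assumes "l \<in> {1..j}" "k + 1 < l"
  shows "pb (\<lambda>y. chain_B l y $ a $ a') (\<lambda>y. iterated_product k y $ b $ b') = 0"
  using assms(2)
proof (induction k arbitrary: b b')
  case 0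
  then show ?case by (simp add: pb_const_right)
next
  case (Suc k)
  then have "Suc k \<in> {1..j}" "Suc k + 1 < l" "k \<le> j" using assms(1) by auto
  then show ?case
    using Suc assms(1)
    by (simp add: pb_matrix_mult_right regular_chain_B regular_iterated_product pb_B_B_zero)
qed

text \<open>Of the factors of \<open>iterated_product k\<close> only the leftmost,
  \<open>B\<^sub>k\<close>, interacts with its successor, and it does so through its row, which is
  also the row of the product. The result has the form required of \<open>XY\<close> in
  \<open>pb_product\<close>.\<close>

lemma pb_B_iterated_product:
  assumes k: "k \<in> {1..<j}" and Q: "Q k \<in> Q_types"
  shows "pb (\<lambda>y. chain_B (Suc k) y $ a $ a') (\<lambda>y. iterated_product k y $ b $ b')
    = Q_coeff (Q k) a' b * chain_B (Suc k) x $ a $ b * iterated_product k x $ a' $ b'"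
proof -
  obtain l where l: "k = Suc l" using k by (cases k) auto
  then have l': "k \<in> {1..j}" "Suc k \<in> {1..j}" "l \<le> j" "l + 1 < Suc k" using k by auto
  have "pb (\<lambda>y. chain_B (Suc k) y $ a $ a') (\<lambda>y. (chain_B k y ** iterated_product l y) $ b $ b')
      = (\<Sum>p\<in>UNIV. Q_coeff (Q k) a' b * chain_B (Suc k) x $ a $ b * chain_B k x $ a' $ p
          * iterated_product l x $ p $ b')"
    unfolding pb_matrix_mult_right[OF regular_chain_B[OF l'(1)] regular_iterated_product[OF l'(3)]]
      pb_B_Suc_B[OF k Q] pb_B_iterated_product_zero[OF l'(2,4)]
    by simp
  then show ?thesis
    unfolding l iterated_product.simps
    by (simp add: matrix_matrix_mult_def[of "chain_B (Suc l) x"] sum_distrib_left mult.assoc)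
qed

lemma pb_iterated_product:
  assumes Q: "\<And>k. k < j \<Longrightarrow> Q k \<in> Q_types"
  shows "1 \<le> k \<Longrightarrow> k \<le> j \<Longrightarrow> pb (\<lambda>y. iterated_product k y $ a $ a') (\<lambda>y. iterated_product k y $ b $ b')
    = BB_rhs (iterated_product k x) $ (a, b) $ (a', b')"
proof (induction k arbitrary: a a' b b')
  case 0
  then show ?case by simp
next
  case (Suc k)
  show ?case
  \<comment> \<open>The product step starts only at \<open>k = 1\<close>: the column of the first B
    is coupled to \<open>A\<close> by \<open>Q 0\<close>, not to the empty product.\<close>
  proof (cases "k = 0")
    case True
    then show ?thesis using Suc.prems pb_B_B[of 1] by simp
  next
    case False
    then have k: "k \<in> {1..<j}" using Suc.prems by auto
    show ?thesis
      unfolding iterated_product.simps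
      by (rule pb_product[OF regular_chain_B regular_iterated_product pb_B_B _ pb_B_iterated_product[OF k Q]])
        (use k Suc in auto)
  qed
qed

text \<open>Only the rightmost factor interacts with \<open>A\<close>, through its column, which is
  also the column of the product. Hence the type stays \<open>Q 0\<close> for every length.\<close>

lemma pb_iterated_product_fst:
  assumes Q: "Q 0 \<in> Q_types"
  shows "1 \<le> k \<Longrightarrow> k \<le> j \<Longrightarrow> pb (\<lambda>y. iterated_product k y $ a $ a') (\<lambda>y. fst y $ b $ b')
    = BA_rhs (Q 0) (iterated_product k x) (fst x) $ (a, b) $ (a', b')"
proof (induction k arbitrary: a a' b b')
  case 0
  then show ?case by simp
next
  case (Suc k)
  show ?case
  proof (cases "k = 0")
    case True
    then show ?thesis using Suc.prems pb_B_fst[OF Q] by simp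
  next
    case False
    then have "k \<ge> 1" "Suc k \<in> {2..j}" "Suc k \<in> {1..j}" "k \<le> j" using Suc.prems by auto
    then show ?thesis
      unfolding iterated_product.simps
      by (simp add: pb_matrix_mult_left regular_chain_B regular_iterated_product pb_B_fst_zero Suc.IH
          BA_rhs_nth[OF Q])
        (simp add: matrix_matrix_mult_def sum_distrib_left sum_distrib_right sum.distrib algebra_simps)
  qed
qed

lemma pb_B_transformed_form_zero:
  assumes "l \<in> {1..j}" "k + 1 < l"
  shows "pb (\<lambda>y. chain_B l y $ a $ a') (\<lambda>y. transformed_form k y $ b $ b') = 0"
  using assms(2)
proof (induction k arbitrary: b b')
  case 0
  then show ?case using assms pb_B_fst_zero[of l] by simp
next
  case (Suc k)
  then have "Suc k \<in> {1..j}" "Suc k + 1 < l" "k \<le> j" using assms(1) by auto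
  then show ?case
    using Suc assms(1)
    by (simp add: pb_congruence_right regular_chain_B regular_transformed_form pb_B_B_zero)
qed

text \<open>For \<open>k > 0\<close> both slots of \<open>transformed_form k\<close> are row slots
  of copies of \<open>B\<^sub>k\<close>. Its successor couples to each copy by the same
  \<open>Q k\<close>, so the one-term bracket of two neighbours becomes the two-term
  \<open>BA_rhs\<close>.\<close>

lemma pb_B_transformed_form:
  assumes k: "k < j" and Q: "Q k \<in> Q_types"
  shows "pb (\<lambda>y. chain_B (Suc k) y $ a $ a') (\<lambda>y. transformed_form k y $ b $ b')
    = BA_rhs (Q k) (chain_B (Suc k) x) (transformed_form k x) $ (a, b) $ (a', b')"
proof (cases k)
  case 0
  then show ?thesis using pb_B_fst k Q by simp
next
  case (Suc l)
  then have k': "k \<in> {1..<j}" "l + 1 < Suc k" "l \<le> j" "Suc k \<in> {1..j}" "k \<in> {1..j}" using k by auto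
  let ?c = "Q_coeff (Q k)" and ?B = "chain_B (Suc k) x" and ?X = "chain_B k x" and ?T = "transformed_form l x"
  have "pb (\<lambda>y. chain_B (Suc k) y $ a $ a')
        (\<lambda>y. (chain_B k y ** transformed_form l y ** transpose (chain_B k y)) $ b $ b')
      = (\<Sum>p\<in>UNIV. \<Sum>q\<in>UNIV. ?c a' b * ?B $ a $ b * (?X $ a' $ p * ?T $ p $ q * ?X $ b' $ q)
          + ?c a' b' * ?B $ a $ b' * (?X $ b $ p * ?T $ p $ q * ?X $ a' $ q))"
    unfolding pb_congruence_right[OF regular_chain_B[OF k'(5)] regular_transformed_form[OF k'(3)]]
      pb_B_Suc_B[OF k'(1) Q] pb_B_transformed_form_zero[OF k'(4,2)]
    by (intro sum.cong refl) (simp add: algebra_simps)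
  then show ?thesis
    unfolding BA_rhs_nth[OF Q] unfolding Suc transformed_form.simps congruence_nth
    by (simp add: sum.distrib sum_distrib_left)
qed

lemma pb_transformed_form:
  assumes Q: "\<And>k. k < j \<Longrightarrow> Q k \<in> Q_types"
  shows "k \<le> j \<Longrightarrow> pb (\<lambda>y. transformed_form k y $ a $ a') (\<lambda>y. transformed_form k y $ b $ b')
    = AA_rhs (transformed_form k x) $ (a, b) $ (a', b')"
proof (induction k arbitrary: a a' b b')
  case 0
  then show ?case using pb_fst_fst by simp
next
  case (Suc k)
  then have k: "k < j" by simp
  show ?case
    unfolding transformed_form.simps
    by (rule pb_congruence[where c = "Q_coeff (Q k)"])
      (use k Suc in \<open>auto intro!: regular_chain_B regular_transformed_form pb_B_B
        simp: pb_B_transformed_form[OF k Q[OF k]] BA_rhs_nth[OF Q[OF k]]\<close>)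
qed

end

section \<open>Poisson maps\<close>

text \<open>For fixed second argument, the bracket of the pullbacks at \<open>x\<close> and the
  bracket on the target at \<open>\<phi> x\<close> are both derivations at \<open>\<phi> x\<close>,
  so agreement on \<open>E\<close> suffices.\<close>

lemma poisson_mapI:
  fixes S :: "'p set" and S' :: "'q set" and E I :: "('q \<Rightarrow> complex) set"
  defines "F' \<equiv> function_algebra S' (E \<union> I)"
  assumes P: "poisson_structure S F br" and P': "poisson_structure S' F' br'"
    and \<phi>: "\<phi> \<in> S \<rightarrow> S'"
    and pull: "\<And>f. f \<in> F' \<Longrightarrow> (\<lambda>x\<in>S. f (\<phi> x)) \<in> F"
    and inv: "\<And>g. g \<in> I \<Longrightarrow> \<exists>h. restrict h S' \<in> function_algebra S' E \<and> (\<forall>y\<in>S'. g y * h y = 1)"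
    and eq: "\<And>e e' x. e \<in> E \<Longrightarrow> e' \<in> E \<Longrightarrow> x \<in> S \<Longrightarrow>
      br (\<lambda>y\<in>S. e (\<phi> y)) (\<lambda>y\<in>S. e' (\<phi> y)) x = br' (restrict e S') (restrict e' S') (\<phi> x)"
  shows "poisson_map S F br S' F' br' \<phi>"
proof -
  define pb where "pb f = (\<lambda>y\<in>S. f (\<phi> y))" for f :: "'q \<Rightarrow> complex"
  have \<phi>': "\<phi> x \<in> S'" if "x \<in> S" for x using \<phi> that by auto
  have pb_in: "pb f \<in> F" if "f \<in> F'" for f using pull[OF that] by (simp add: pb_def)
  have pb_restrict: "pb (restrict f S') = (\<lambda>y\<in>S. f (\<phi> y))" for f
    unfolding pb_def by (intro restrict_ext) (simp add: \<phi>')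
  have pb_lin: "pb (\<lambda>y\<in>S'. c * f y + g y) = (\<lambda>y\<in>S. c * pb f y + pb g y)"
    and pb_mult: "pb (\<lambda>y\<in>S'. f y * g y) = (\<lambda>y\<in>S. pb f y * pb g y)" for c f g
    unfolding pb_restrict by (intro restrict_ext, simp add: pb_def)+
  have gen: "restrict e S' \<in> F'" if "e \<in> E" for e
    using that unfolding F'_def by (auto intro: function_algebra.gen)
  have der: "derivation_at S' F' (\<phi> x) (\<lambda>f. br (pb f) (pb h) x)" if "h \<in> F'" "x \<in> S" for h x
  proof -
    have "derivation_at S F x (\<lambda>f. br f (pb h) x)"
      using poisson_structure_derivation_left[OF P pb_in[OF that(1)] that(2)] .
    then have lin: "br (\<lambda>y\<in>S. c * f y + g y) (pb h) x = c * br f (pb h) x + br g (pb h) x"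
      and leib: "br (\<lambda>y\<in>S. f y * g y) (pb h) x = f x * br g (pb h) x + br f (pb h) x * g x"
      if "f \<in> F" "g \<in> F" for c f g
      using that unfolding derivation_at_def by blast+
    have pb_x: "pb f x = f (\<phi> x)" for f using that(2) by (simp add: pb_def)
    show ?thesis
      unfolding derivation_at_def pb_lin pb_mult
      by (intro conjI allI ballI) (simp_all only: lin leib pb_in pb_x)
  qed
  have extend: "br (pb f) (pb h) x = br' f h (\<phi> x)"
    if base: "\<And>e. e \<in> E \<Longrightarrow> br (pb (restrict e S')) (pb h) x = br' (restrict e S') h (\<phi> x)"
      and h: "h \<in> F'" and x: "x \<in> S" and f: "f \<in> F'" for f h x
    by (rule derivation_at_eqI[OF \<phi>'[OF x] der[OF h x, unfolded F'_def]
          poisson_structure_derivation_left[OF P' h \<phi>'[OF x], unfolded F'_def] base inv f[unfolded F'_def]])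
  \<comment> \<open>The first argument is freed while the second is a generator; skew-symmetry of
    both brackets turns this into the base case for freeing the other argument.\<close>
  have 1: "br (pb f) (pb (restrict e S')) x = br' f (restrict e S') (\<phi> x)"
    if "f \<in> F'" "e \<in> E" "x \<in> S" for f e x
    by (rule extend[OF _ gen[OF that(2)] that(3,1)]) (simp add: pb_restrict eq that)
  have "br (pb f) (pb h) x = br' f h (\<phi> x)" if "f \<in> F'" "h \<in> F'" "x \<in> S" for f h x
  proof (rule extend[OF _ that(2,3,1)])
    fix e assume e: "e \<in> E"
    show "br (pb (restrict e S')) (pb h) x = br' (restrict e S') h (\<phi> x)"
      using 1[OF that(2) e that(3)]
        poisson_structure_skew[OF P pb_in[OF gen[OF e]] pb_in[OF that(2)] that(3)]
        poisson_structure_skew[OF P' gen[OF e] that(2) \<phi>'[OF that(3)]] by simp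
  qed
  then show ?thesis
    unfolding poisson_map_def using \<phi> pull by (simp add: pb_def)
qed

text \<open>Transport along the bijection \<alpha> with inverse \<psi>. In nested brackets the
  pullback of a bracket must equal the bracket of the pullbacks as a function, not only on
  \<open>S\<close>; this is where \<open>ext\<close> enters.\<close>

lemma poisson_structure_transport:
  assumes P: "poisson_structure S F br"
    and \<alpha>: "\<And>x. x \<in> S \<Longrightarrow> \<alpha> x \<in> S'" and \<psi>: "\<And>y. y \<in> S' \<Longrightarrow> \<psi> y \<in> S"
    and \<psi>\<alpha>: "\<And>x. x \<in> S \<Longrightarrow> \<psi> (\<alpha> x) = x" and \<alpha>\<psi>: "\<And>y. y \<in> S' \<Longrightarrow> \<alpha> (\<psi> y) = y"
    and pull: "\<And>f. f \<in> F' \<Longrightarrow> (\<lambda>x\<in>S. f (\<alpha> x)) \<in> F"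
    and push: "\<And>f. f \<in> F \<Longrightarrow> (\<lambda>y\<in>S'. f (\<psi> y)) \<in> F'"
    and ext: "\<And>f. f \<in> F \<Longrightarrow> restrict f S = f"
  shows "poisson_structure S' F' (\<lambda>f g. \<lambda>y\<in>S'. br (\<lambda>x\<in>S. f (\<alpha> x)) (\<lambda>x\<in>S. g (\<alpha> x)) (\<psi> y))"
proof -
  define pb where "pb f = (\<lambda>x\<in>S. f (\<alpha> x))" for f :: "'b \<Rightarrow> complex"
  define br' where "br' f g = (\<lambda>y\<in>S'. br (pb f) (pb g) (\<psi> y))" for f g
  have pb_in: "pb f \<in> F" if "f \<in> F'" for f using pull[OF that] by (simp add: pb_def)
  have pb_lin: "pb (\<lambda>y\<in>S'. c * f y + g y) = (\<lambda>x\<in>S. c * pb f x + pb g x)"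
    and pb_mult: "pb (\<lambda>y\<in>S'. f y * g y) = (\<lambda>x\<in>S. pb f x * pb g x)" for c f g
    unfolding pb_def by (intro restrict_ext, simp add: \<alpha>)+
  have lin: "br (\<lambda>y\<in>S. c * f y + g y) h x = c * br f h x + br g h x"
    and leib: "br (\<lambda>y\<in>S. f y * g y) h x = f x * br g h x + br f h x * g x"
    and jacobi: "br f (br g h) x + br g (br h f) x + br h (br f g) x = 0"
    if "f \<in> F" "g \<in> F" "h \<in> F" "x \<in> S" for c f g h x
    using P that unfolding poisson_structure_def by blast+
  have pb_\<psi>: "pb f (\<psi> y) = f y" if "y \<in> S'" for f y
    using that by (simp add: pb_def \<psi> \<alpha>\<psi>)
  have closed: "br' f g \<in> F'" if "f \<in> F'" "g \<in> F'" for f g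
    unfolding br'_def by (intro push poisson_structure_closed[OF P] pb_in that)
  have pb_br: "pb (br' f g) = br (pb f) (pb g)" if "f \<in> F'" "g \<in> F'" for f g
  proof -
    have "pb (br' f g) = restrict (br (pb f) (pb g)) S"
      unfolding pb_def[of "br' f g"] by (intro restrict_ext) (simp add: br'_def \<alpha> \<psi>\<alpha>)
    then show ?thesis using ext poisson_structure_closed[OF P] pb_in that by simp
  qed
  have "poisson_structure S' F' br'"
    unfolding poisson_structure_def
  proof (intro conjI ballI allI)
    show "br' f g y = - br' g f y" if "f \<in> F'" "g \<in> F'" "y \<in> S'" for f g y
      using poisson_structure_skew[OF P pb_in[OF that(1)] pb_in[OF that(2)] \<psi>[OF that(3)]] that(3)
      by (simp add: br'_def)
    show "br' (\<lambda>y\<in>S'. c * f y + g y) h y = c * br' f h y + br' g h y"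
      if "f \<in> F'" "g \<in> F'" "h \<in> F'" "y \<in> S'" for c f g h y
      using that by (simp add: br'_def pb_lin lin pb_in \<psi>)
    show "br' (\<lambda>y\<in>S'. f y * g y) h y = f y * br' g h y + br' f h y * g y"
      if "f \<in> F'" "g \<in> F'" "h \<in> F'" "y \<in> S'" for f g h y
      using that by (simp add: br'_def pb_mult leib pb_in \<psi> pb_\<psi>)
    show "br' f (br' g h) y + br' g (br' h f) y + br' h (br' f g) y = 0"
      if "f \<in> F'" "g \<in> F'" "h \<in> F'" "y \<in> S'" for f g h y
      unfolding br'_def[of f "br' g h"] br'_def[of g "br' h f"] br'_def[of h "br' f g"]
        pb_br[OF that(1,2)] pb_br[OF that(2,3)] pb_br[OF that(3,1)]
      using that by (simp add: jacobi pb_in \<psi>)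
  qed (fact closed)
  then show ?thesis unfolding br'_def pb_def .
qed

section \<open>Pairs as chains of length one\<close>

definition pair_matrix :: "nat \<Rightarrow> 'n::finite cmatrix \<times> 'n cmatrix \<Rightarrow> 'n cmatrix" where
  "pair_matrix k y = (if k = 0 then fst y else snd y)"

definition pair_of_chain :: "'n::finite chain \<Rightarrow> 'n cmatrix \<times> 'n cmatrix" where
  "pair_of_chain x = (fst x, chain_B 1 x)"

definition chain_of_pair :: "'n::finite cmatrix \<times> 'n cmatrix \<Rightarrow> 'n chain" where
  "chain_of_pair y = (fst y, \<lambda>k\<in>{1..1}. snd y)"

text \<open>The witness for the existential in \<open>poisson_to_pairs\<close>. A pair of type
  \<open>q\<close> is a chain of length one whose \<open>Q 0\<close> is \<open>q\<close>, so the
  Jacobi identity is inherited from chains.\<close>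

definition pair_bracket :: "'n::{finite,linorder} tensor \<Rightarrow> ('n cmatrix \<times> 'n cmatrix) bracket" where
  "pair_bracket q f g = (\<lambda>y\<in>pairs. chain_bracket 1 (\<lambda>_. q)
     (\<lambda>x\<in>chain_space 1. f (pair_of_chain x)) (\<lambda>x\<in>chain_space 1. g (pair_of_chain x)) (chain_of_pair y))"

definition pair_coords :: "('n::finite cmatrix \<times> 'n cmatrix \<Rightarrow> complex) set" where
  "pair_coords = {\<lambda>y. pair_matrix k y $ a $ b | k a b. k \<le> 1}"

lemma pair_functions_eq:
  "pair_functions = function_algebra pairs (pair_coords \<union> {\<lambda>y. inverse (det (snd y))})"
proof -
  have "({\<lambda>y. fst y $ a $ b | a b. True} \<union> {\<lambda>y. snd y $ a $ b | a b. True}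
      :: ('a cmatrix \<times> 'a cmatrix \<Rightarrow> complex) set) = pair_coords" (is "?A \<union> ?B = _")
  proof (intro antisym subsetI)
    fix f assume "f \<in> ?A \<union> ?B"
    then consider a b where "f = (\<lambda>y. fst y $ a $ b)" | a b where "f = (\<lambda>y. snd y $ a $ b)"
      by blast
    then show "f \<in> pair_coords"
    proof cases
      case (1 a b)
      then have "f = (\<lambda>y. pair_matrix 0 y $ a $ b)" by (simp add: pair_matrix_def)
      then show ?thesis unfolding pair_coords_def by blast
    next
      case (2 a b)
      then have "f = (\<lambda>y. pair_matrix 1 y $ a $ b)" by (simp add: pair_matrix_def)
      then show ?thesis unfolding pair_coords_def by blast
    qed
  next
    fix f :: "'a cmatrix \<times> 'a cmatrix \<Rightarrow> complex" assume "f \<in> pair_coords"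
    then obtain k a b where "f = (\<lambda>y. pair_matrix k y $ a $ b)" by (auto simp: pair_coords_def)
    then show "f \<in> ?A \<union> ?B" by (cases "k = 0") (auto simp: pair_matrix_def)
  qed
  then show ?thesis unfolding pair_functions_def by simp
qed

lemma pair_inverse_det_inverse:
  "\<exists>h. restrict h pairs \<in> function_algebra pairs pair_coords
    \<and> (\<forall>y\<in>pairs. inverse (det (snd y)) * h y = (1 :: complex))"
proof (intro exI conjI ballI)
  have "(\<lambda>y\<in>pairs. snd y $ a $ b) \<in> function_algebra pairs pair_coords" for a b :: 'a
  proof (rule function_algebra.gen)
    have "(\<lambda>y. snd y $ a $ b) = (\<lambda>y. pair_matrix 1 y $ a $ b)" by (simp add: pair_matrix_def)
    then show "(\<lambda>y. snd y $ a $ b) \<in> pair_coords" unfolding pair_coords_def by blast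
  qed
  then show "(\<lambda>y\<in>pairs. det (snd y)) \<in> function_algebra pairs (pair_coords :: ('a cmatrix \<times> _ \<Rightarrow> _) set)"
    by (rule function_algebra_det)
  show "inverse (det (snd y)) * det (snd y) = 1" if "y \<in> pairs" for y :: "'a cmatrix \<times> 'a cmatrix"
    using that by (auto simp: pairs_def GL_def invertible_det_nz)
qed

lemma pair_functions_pullback:
  fixes \<phi> :: "'n::finite chain \<Rightarrow> 'n cmatrix \<times> 'n cmatrix"
  assumes \<phi>: "\<phi> \<in> chain_space j \<rightarrow> pairs"
    and fst: "\<And>a b. (\<lambda>x\<in>chain_space j. fst (\<phi> x) $ a $ b) \<in> chain_functions j"
    and snd: "\<And>a b. (\<lambda>x\<in>chain_space j. snd (\<phi> x) $ a $ b) \<in> chain_functions j"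
    and det: "(\<lambda>x\<in>chain_space j. inverse (det (snd (\<phi> x)))) \<in> chain_functions j"
    and f: "f \<in> pair_functions"
  shows "(\<lambda>x\<in>chain_space j. f (\<phi> x)) \<in> chain_functions j"
  unfolding chain_functions_def
proof (rule function_algebra_pullback[OF \<phi> _ f[unfolded pair_functions_def]], fold chain_functions_def)
  fix g :: "'n cmatrix \<times> 'n cmatrix \<Rightarrow> complex"
  assume "g \<in> {\<lambda>y. fst y $ a $ b | a b. True} \<union> {\<lambda>y. snd y $ a $ b | a b. True}
      \<union> {\<lambda>y. inverse (det (snd y))}"
  then consider a b where "g = (\<lambda>y. fst y $ a $ b)" | a b where "g = (\<lambda>y. snd y $ a $ b)"
    | "g = (\<lambda>y. inverse (det (snd y)))"
    by blast
  then show "(\<lambda>x\<in>chain_space j. g (\<phi> x)) \<in> chain_functions j"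
    by cases (simp_all only: fst snd det)
qed

lemma pair_of_chain_in: "x \<in> chain_space 1 \<Longrightarrow> pair_of_chain x \<in> pairs"
  by (simp add: pair_of_chain_def chain_space_def pairs_def mem_Times_iff PiE_iff)

lemma chain_of_pair_in: "y \<in> pairs \<Longrightarrow> chain_of_pair y \<in> chain_space 1"
  by (simp add: chain_of_pair_def chain_space_def pairs_def mem_Times_iff)

lemma chain_of_pair_of_chain: "x \<in> chain_space 1 \<Longrightarrow> chain_of_pair (pair_of_chain x) = x"
  by (cases x) (fastforce simp: chain_of_pair_def pair_of_chain_def chain_space_def PiE_iff
      extensional_def restrict_def)

lemma pair_of_chain_of_pair: "pair_of_chain (chain_of_pair y) = y"
  by (simp add: chain_of_pair_def pair_of_chain_def)

lemma chain_inverse_det_in: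
  "k \<in> {1..j} \<Longrightarrow> (\<lambda>x\<in>chain_space j. inverse (det (chain_B k x))) \<in> chain_functions j"
  unfolding chain_functions_def by (intro function_algebra.gen) auto

lemma chain_B_in_functions:
  "k \<in> {1..j} \<Longrightarrow> (\<lambda>x\<in>chain_space j. chain_B k x $ a $ b) \<in> chain_functions j"
  using chain_matrix_in[of k j a b] by (auto simp: chain_matrix_def)

lemma fst_in_functions: "(\<lambda>x\<in>chain_space j. fst x $ a $ b) \<in> chain_functions j"
  using chain_matrix_in[of 0 j a b] by (simp add: chain_matrix_def)

lemma pair_of_chain_pullback:
  "f \<in> pair_functions \<Longrightarrow> (\<lambda>x\<in>chain_space 1. f (pair_of_chain x)) \<in> chain_functions 1"
  by (rule pair_functions_pullback)
    (rule Pi_I, rule pair_of_chain_in, simp_all add: pair_of_chain_def chain_B_in_functions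
      fst_in_functions chain_inverse_det_in)

lemma chain_of_pair_pullback:
  assumes "f \<in> chain_functions 1"
  shows "(\<lambda>y\<in>pairs. f (chain_of_pair y)) \<in> pair_functions"
  using assms unfolding pair_functions_def chain_functions_def
proof (rule function_algebra_pullback[rotated 2])
  show "chain_of_pair \<in> pairs \<rightarrow> chain_space 1" using chain_of_pair_in by blast
  fix g :: "'a chain \<Rightarrow> complex"
  assume "g \<in> {\<lambda>x. fst x $ a $ b |a b. True} \<union> {\<lambda>x. chain_B k x $ a $ b |k a b. k \<in> {1..1}}
      \<union> {\<lambda>x. inverse (det (chain_B k x)) |k. k \<in> {1..1}}"
  then consider a b where "g = (\<lambda>x. fst x $ a $ b)" | a b where "g = (\<lambda>x. chain_B 1 x $ a $ b)"
    | "g = (\<lambda>x. inverse (det (chain_B 1 x)))"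
    unfolding atLeastAtMost_singleton by blast
  then have "(\<lambda>y. g (chain_of_pair y)) \<in> {\<lambda>y. fst y $ a $ b |a b. True} \<union> {\<lambda>y. snd y $ a $ b |a b. True}
      \<union> {\<lambda>y. inverse (det (snd y))}"
  proof cases
    case (1 a b)
    then have "(\<lambda>y. g (chain_of_pair y)) = (\<lambda>y. fst y $ a $ b)" by (simp add: chain_of_pair_def)
    then show ?thesis by blast
  next
    case (2 a b)
    then have "(\<lambda>y. g (chain_of_pair y)) = (\<lambda>y. snd y $ a $ b)" by (simp add: chain_of_pair_def)
    then show ?thesis by blast
  next
    case 3
    then have "(\<lambda>y. g (chain_of_pair y)) = (\<lambda>y. inverse (det (snd y)))"
      by (simp add: chain_of_pair_def)
    then show ?thesis by blast
  qed
  then show "(\<lambda>y\<in>pairs. g (chain_of_pair y)) \<in> function_algebra pairs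
      ({\<lambda>y. fst y $ a $ b |a b. True} \<union> {\<lambda>y. snd y $ a $ b |a b. True} \<union> {\<lambda>y. inverse (det (snd y))})"
    by (rule function_algebra.gen)
qed

lemma pair_bracket_poisson:
  fixes q :: "'n::{finite,linorder} tensor"
  shows "poisson_structure pairs pair_functions (pair_bracket q)"
  using poisson_structure_transport[OF chain_bracket_poisson[of 1 "\<lambda>_. q"] pair_of_chain_in
      chain_of_pair_in chain_of_pair_of_chain pair_of_chain_of_pair pair_of_chain_pullback
      chain_of_pair_pullback]
  unfolding pair_bracket_def[abs_def] by (simp add: chain_functions_def restrict_in_function_algebra)

lemma pair_bracket_matrix:
  assumes "y \<in> pairs" "k \<le> 1" "l \<le> 1"
  shows "pair_bracket q (\<lambda>y\<in>pairs. pair_matrix k y $ a $ a') (\<lambda>y\<in>pairs. pair_matrix l y $ b $ b') y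
    = exchange (chain_coeff (\<lambda>_. q)) k l (pair_matrix k y) (pair_matrix l y) a a' b b'"
proof -
  have pull: "(\<lambda>x\<in>chain_space 1. (\<lambda>y\<in>pairs. pair_matrix m y $ d $ d') (pair_of_chain x))
      = (\<lambda>x\<in>chain_space 1. chain_matrix m x $ d $ d')" if "m \<le> 1" for m d d'
    using that
    by (intro restrict_ext) (auto simp: pair_of_chain_in, auto simp: pair_of_chain_def
        pair_matrix_def chain_matrix_def le_Suc_eq)
  interpret chain_point 1 "\<lambda>_. q" "chain_of_pair y"
    by standard (rule chain_of_pair_in[OF assms(1)])
  have "chain_matrix m (chain_of_pair y) = pair_matrix m y" if "m \<le> 1" for m
    using that by (auto simp: chain_of_pair_def pair_matrix_def chain_matrix_def le_Suc_eq)
  then show ?thesis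
    using pb_chain_matrix[OF assms(2,3)] assms
    unfolding pb_def pair_bracket_def restrict_apply'[OF assms(1)] pull[OF assms(2)] pull[OF assms(3)]
    by simp
qed

lemma pair_bracket_of_type:
  assumes q: "q \<in> Q_types"
  shows "pair_of_type q (pair_bracket q)"
proof -
  have "tensor_bracket pairs (pair_bracket q) fst fst y = AA_rhs (fst y)" if "y \<in> pairs" for y
    using pair_bracket_matrix[OF that, of 0 0 q]
    by (simp add: tensor_bracket_def vec_eq_iff pair_matrix_def exchange_AA)
  moreover have "tensor_bracket pairs (pair_bracket q) snd snd y = BB_rhs (snd y)" if "y \<in> pairs" for y
    using pair_bracket_matrix[OF that, of 1 1 q]
    by (simp add: tensor_bracket_def vec_eq_iff pair_matrix_def exchange_BB)
  moreover have "tensor_bracket pairs (pair_bracket q) snd fst y = BA_rhs q (snd y) (fst y)"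
    if "y \<in> pairs" for y
    using pair_bracket_matrix[OF that, of 1 0 q] exchange_BA[of "\<lambda>_. q"] q
    by (simp add: tensor_bracket_def vec_eq_iff pair_matrix_def)
  ultimately show ?thesis
    unfolding pair_of_type_def using pair_bracket_poisson by blast
qed

text \<open>Turns each map in the definition of compatibility into three entrywise bracket
  computations plus regularity of its components and of the inverse determinant.\<close>

lemma poisson_to_pairsI:
  fixes M0 M1 :: "'n::{finite,linorder} chain \<Rightarrow> 'n cmatrix"
  assumes q: "q \<in> Q_types"
    and GL: "\<And>x. x \<in> chain_space j \<Longrightarrow> M1 x \<in> GL"
    and M0: "\<And>a b. (\<lambda>x\<in>chain_space j. M0 x $ a $ b) \<in> chain_functions j"
    and M1: "\<And>a b. (\<lambda>x\<in>chain_space j. M1 x $ a $ b) \<in> chain_functions j"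
    and det: "(\<lambda>x\<in>chain_space j. inverse (det (M1 x))) \<in> chain_functions j"
    and 00: "\<And>x a a' b b'. x \<in> chain_space j \<Longrightarrow>
      chain_bracket j Q (\<lambda>y\<in>chain_space j. M0 y $ a $ a') (\<lambda>y\<in>chain_space j. M0 y $ b $ b') x
      = AA_rhs (M0 x) $ (a, b) $ (a', b')"
    and 11: "\<And>x a a' b b'. x \<in> chain_space j \<Longrightarrow>
      chain_bracket j Q (\<lambda>y\<in>chain_space j. M1 y $ a $ a') (\<lambda>y\<in>chain_space j. M1 y $ b $ b') x
      = BB_rhs (M1 x) $ (a, b) $ (a', b')"
    and 10: "\<And>x a a' b b'. x \<in> chain_space j \<Longrightarrow>
      chain_bracket j Q (\<lambda>y\<in>chain_space j. M1 y $ a $ a') (\<lambda>y\<in>chain_space j. M0 y $ b $ b') x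
      = BA_rhs q (M1 x) (M0 x) $ (a, b) $ (a', b')"
  shows "poisson_to_pairs j (chain_bracket j Q) q (\<lambda>x. (M0 x, M1 x))"
proof -
  define \<phi> where "\<phi> = (\<lambda>x. (M0 x, M1 x))"
  have \<phi>: "\<phi> \<in> chain_space j \<rightarrow> pairs" using GL by (auto simp: \<phi>_def pairs_def)
  have "poisson_map (chain_space j) (chain_functions j) (chain_bracket j Q) pairs pair_functions
      (pair_bracket q) \<phi>"
    unfolding pair_functions_eq
  proof (rule poisson_mapI, unfold pair_functions_eq[symmetric])
    show "(\<lambda>x\<in>chain_space j. f (\<phi> x)) \<in> chain_functions j" if "f \<in> pair_functions" for f
      by (rule pair_functions_pullback[OF \<phi> _ _ _ that]) (simp_all add: \<phi>_def M0 M1 det)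
    show "\<exists>h. restrict h pairs \<in> function_algebra pairs pair_coords \<and> (\<forall>y\<in>pairs. g y * h y = 1)"
      if "g \<in> {\<lambda>y. inverse (det (snd y))}" for g :: "'n cmatrix \<times> 'n cmatrix \<Rightarrow> complex"
      using that pair_inverse_det_inverse by simp
    fix e e' :: "'n cmatrix \<times> 'n cmatrix \<Rightarrow> complex" and x :: "'n chain"
    assume "e \<in> pair_coords" "e' \<in> pair_coords" and x: "x \<in> chain_space j"
    then obtain k l a a' b b' where le: "k \<le> 1" "l \<le> 1"
      and e: "e = (\<lambda>y. pair_matrix k y $ a $ a')" and e': "e' = (\<lambda>y. pair_matrix l y $ b $ b')"
      by (auto simp: pair_coords_def)
    have \<phi>x: "\<phi> x \<in> pairs" using \<phi> x by auto
    have BA: "exchange (chain_coeff (\<lambda>_. q)) 1 0 B A i j k l = BA_rhs q B A $ (i, k) $ (j, l)"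
      for A B :: "'n cmatrix" and i j k l
      using exchange_BA[of "\<lambda>_. q"] q by simp
    consider "k = 0" "l = 0" | "k = 1" "l = 1" | "k = 1" "l = 0" | "k = 0" "l = 1"
      using le by linarith
    then show "chain_bracket j Q (\<lambda>y\<in>chain_space j. e (\<phi> y)) (\<lambda>y\<in>chain_space j. e' (\<phi> y)) x
      = pair_bracket q (restrict e pairs) (restrict e' pairs) (\<phi> x)"
      unfolding e e' pair_bracket_matrix[OF \<phi>x le]
    proof cases
      case 1
      then show "chain_bracket j Q (\<lambda>y\<in>chain_space j. pair_matrix k (\<phi> y) $ a $ a')
          (\<lambda>y\<in>chain_space j. pair_matrix l (\<phi> y) $ b $ b') x
        = exchange (chain_coeff (\<lambda>_. q)) k l (pair_matrix k (\<phi> x)) (pair_matrix l (\<phi> x)) a a' b b'"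
        by (simp add: \<phi>_def pair_matrix_def exchange_AA 00[OF x])
    next
      case 2
      then show "chain_bracket j Q (\<lambda>y\<in>chain_space j. pair_matrix k (\<phi> y) $ a $ a')
          (\<lambda>y\<in>chain_space j. pair_matrix l (\<phi> y) $ b $ b') x
        = exchange (chain_coeff (\<lambda>_. q)) k l (pair_matrix k (\<phi> x)) (pair_matrix l (\<phi> x)) a a' b b'"
        by (simp add: \<phi>_def pair_matrix_def exchange_BB 11[OF x])
    next
      case 3
      then show "chain_bracket j Q (\<lambda>y\<in>chain_space j. pair_matrix k (\<phi> y) $ a $ a')
          (\<lambda>y\<in>chain_space j. pair_matrix l (\<phi> y) $ b $ b') x
        = exchange (chain_coeff (\<lambda>_. q)) k l (pair_matrix k (\<phi> x)) (pair_matrix l (\<phi> x)) a a' b b'"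
        by (simp add: \<phi>_def pair_matrix_def BA[unfolded One_nat_def] 10[OF x])
    next
      case 4
      then show "chain_bracket j Q (\<lambda>y\<in>chain_space j. pair_matrix k (\<phi> y) $ a $ a')
          (\<lambda>y\<in>chain_space j. pair_matrix l (\<phi> y) $ b $ b') x
        = exchange (chain_coeff (\<lambda>_. q)) k l (pair_matrix k (\<phi> x)) (pair_matrix l (\<phi> x)) a a' b b'"
        by (subst chain_bracket_skew[OF x], subst exchange_skew[of "chain_coeff _", OF chain_coeff_skew])
          (simp add: \<phi>_def pair_matrix_def BA[unfolded One_nat_def] 10[OF x])
    qed
  qed (fact chain_bracket_poisson pair_bracket_poisson \<phi>)+
  then show ?thesis
    unfolding poisson_to_pairs_def \<phi>_def using pair_bracket_of_type[OF q] by blast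
qed

section \<open>Compatibility with the multiple product\<close>

lemma identity_chain_in: "(mat 1, \<lambda>k\<in>{1..j}. mat 1) \<in> chain_space j"
  by (auto simp: chain_space_def GL_def invertible_det_nz)

lemma iterated_product_in:
  fixes a :: "'n::{finite,linorder}"
  assumes "k \<le> j"
  shows "(\<lambda>x\<in>chain_space j. iterated_product k x $ a $ b) \<in> chain_functions j"
proof -
  \<comment> \<open>Regularity refers neither to the evaluation point nor to \<open>Q\<close>, so
    the identity chain and the zero family serve merely as inhabitants of the locale.\<close>
  interpret chain_point j "\<lambda>_. 0" "(mat 1, \<lambda>k\<in>{1..j}. mat 1) :: 'n chain"
    by standard (rule identity_chain_in)
  show ?thesis
    using regular_iterated_product[OF assms] by (simp add: regular_matrix_def regular_def)
qed

lemma transformed_form_in: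
  fixes a :: "'n::{finite,linorder}"
  assumes "k \<le> j"
  shows "(\<lambda>x\<in>chain_space j. transformed_form k x $ a $ b) \<in> chain_functions j"
proof -
  interpret chain_point j "\<lambda>_. 0" "(mat 1, \<lambda>k\<in>{1..j}. mat 1) :: 'n chain"
    by standard (rule identity_chain_in)
  show ?thesis
    using regular_transformed_form[OF assms] by (simp add: regular_matrix_def regular_def)
qed

lemma iterated_product_GL:
  "x \<in> chain_space j \<Longrightarrow> k \<le> j \<Longrightarrow> iterated_product k x \<in> GL"
proof (induction k)
  case 0
  then show ?case by (simp add: GL_def invertible_det_nz)
next
  case (Suc k)
  then have "chain_B (Suc k) x \<in> GL" by (auto simp: chain_space_def)
  then show ?case using Suc by (simp add: GL_def invertible_det_nz det_mul)
qed

lemma iterated_product_inverse_det: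
  "k \<le> j \<Longrightarrow> (\<lambda>x\<in>chain_space j. inverse (det (iterated_product k x))) \<in> chain_functions j"
proof (induction k)
  case 0
  then show ?case by (simp add: chain_functions_intros)
next
  case (Suc k)
  then show ?case by (simp add: det_mul chain_functions_intros chain_inverse_det_in)
qed

lemma chain_bracket_compatible:
  fixes Q :: "nat \<Rightarrow> 'n::{finite,linorder} tensor"
  assumes j: "j \<ge> 1" and Q: "\<And>k. k < j \<Longrightarrow> Q k \<in> Q_types"
  shows "compatible_with_multiple_product j Q (chain_bracket j Q)"
  unfolding compatible_with_multiple_product_def
proof (intro conjI ballI)
  show "poisson_to_pairs j (chain_bracket j Q) (Q 0) (\<lambda>x. (fst x, iterated_product j x))"
  proof (rule poisson_to_pairsI)
    fix x :: "'n chain" assume x: "x \<in> chain_space j"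
    then interpret chain_point j Q x by (rule chain_point.intro)
    show "iterated_product j x \<in> GL" using x by (simp add: iterated_product_GL)
    show "chain_bracket j Q (\<lambda>y\<in>chain_space j. fst y $ a $ a') (\<lambda>y\<in>chain_space j. fst y $ b $ b') x
      = AA_rhs (fst x) $ (a, b) $ (a', b')" for a a' b b'
      using pb_fst_fst by (simp add: pb_def)
    show "chain_bracket j Q (\<lambda>y\<in>chain_space j. iterated_product j y $ a $ a')
        (\<lambda>y\<in>chain_space j. iterated_product j y $ b $ b') x
      = BB_rhs (iterated_product j x) $ (a, b) $ (a', b')" for a a' b b'
      using pb_iterated_product[OF Q j] by (simp add: pb_def)
    show "chain_bracket j Q (\<lambda>y\<in>chain_space j. iterated_product j y $ a $ a')
        (\<lambda>y\<in>chain_space j. fst y $ b $ b') x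
      = BA_rhs (Q 0) (iterated_product j x) (fst x) $ (a, b) $ (a', b')" for a a' b b'
      using pb_iterated_product_fst[OF Q j] j by (simp add: pb_def)
  qed (use j in \<open>simp_all add: Q fst_in_functions iterated_product_in iterated_product_inverse_det\<close>)
next
  fix k assume k: "k \<in> {1..j}"
  then have k': "k - 1 < j" "k - 1 \<le> j" "Suc (k - 1) = k" by auto
  show "poisson_to_pairs j (chain_bracket j Q) (Q (k - 1)) (\<lambda>x. (transformed_form (k - 1) x, chain_B k x))"
  proof (rule poisson_to_pairsI)
    fix x :: "'n chain" assume x: "x \<in> chain_space j"
    then interpret chain_point j Q x by (rule chain_point.intro)
    show "chain_B k x \<in> GL" using x k by (auto simp: chain_space_def)
    show "chain_bracket j Q (\<lambda>y\<in>chain_space j. transformed_form (k - 1) y $ a $ a')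
        (\<lambda>y\<in>chain_space j. transformed_form (k - 1) y $ b $ b') x
      = AA_rhs (transformed_form (k - 1) x) $ (a, b) $ (a', b')" for a a' b b'
      using pb_transformed_form[OF Q k'(2)] by (simp add: pb_def)
    show "chain_bracket j Q (\<lambda>y\<in>chain_space j. chain_B k y $ a $ a')
        (\<lambda>y\<in>chain_space j. chain_B k y $ b $ b') x
      = BB_rhs (chain_B k x) $ (a, b) $ (a', b')" for a a' b b'
      using pb_B_B[OF k] by (simp add: pb_def)
    show "chain_bracket j Q (\<lambda>y\<in>chain_space j. chain_B k y $ a $ a')
        (\<lambda>y\<in>chain_space j. transformed_form (k - 1) y $ b $ b') x
      = BA_rhs (Q (k - 1)) (chain_B k x) (transformed_form (k - 1) x) $ (a, b) $ (a', b')" for a a' b b'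
      using pb_B_transformed_form[OF k'(1) Q[OF k'(1)]] unfolding k'(3) by (simp add: pb_def)
  qed (use k k' in \<open>simp_all add: Q transformed_form_in chain_B_in_functions chain_inverse_det_in\<close>)
qed

section \<open>Uniqueness\<close>

lemma chain_formulas_coord:
  fixes br :: "'n::{finite,linorder} chain bracket"
  assumes P: "poisson_structure (chain_space j) (chain_functions j) br" and formulas: "chain_formulas j Q br"
    and P': "poisson_structure (chain_space j) (chain_functions j) br'" and formulas': "chain_formulas j Q br'"
    and x: "x \<in> chain_space j" and le: "k \<le> j" "l \<le> j"
  shows "br (\<lambda>y\<in>chain_space j. chain_matrix k y $ a $ a') (\<lambda>y\<in>chain_space j. chain_matrix l y $ b $ b') x
    = br' (\<lambda>y\<in>chain_space j. chain_matrix k y $ a $ a') (\<lambda>y\<in>chain_space j. chain_matrix l y $ b $ b') x"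
proof -
  have M: "chain_matrix 0 = (fst :: 'n chain \<Rightarrow> _)" "\<And>k. k \<noteq> 0 \<Longrightarrow> chain_matrix k = (chain_B k :: 'n chain \<Rightarrow> _)"
    by (auto simp: chain_matrix_def)
  have eq: "tensor_bracket (chain_space j) br (chain_matrix k) (chain_matrix l) x
      = tensor_bracket (chain_space j) br' (chain_matrix k) (chain_matrix l) x"
    if "l \<le> k" "k \<le> j" for k l
  proof -
    note F = formulas[unfolded chain_formulas_def, THEN bspec, OF x]
    note F' = formulas'[unfolded chain_formulas_def, THEN bspec, OF x]
    \<comment> \<open>With \<open>l\<close> at most \<open>k\<close>, every pair of matrices falls
      under one clause of \<open>chain_formulas\<close>; the opposite order is left to
      skew-symmetry.\<close>
    have "k = 0 \<and> l = 0 \<or> k = 1 \<and> l = 0 \<or> 2 \<le> k \<and> l = 0 \<or> 1 \<le> k \<and> l = k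
        \<or> 1 \<le> l \<and> k = l + 1 \<or> 1 \<le> l \<and> l + 1 < k"
      using that(1) by presburger
    then consider "k = 0" "l = 0" | "k = 1" "l = 0" | "2 \<le> k" "l = 0" | "1 \<le> k" "l = k"
      | "1 \<le> l" "k = l + 1" | "1 \<le> l" "l + 1 < k"
      by blast
    then show ?thesis
    proof cases
      case 1
      then show ?thesis using F F' by (simp only: M)
    next
      case 2
      then show ?thesis using F F' by (simp only: M one_neq_zero not_False_eq_True)
    next
      case 3
      then have "k \<in> {2..j}" "chain_matrix k = (chain_B k :: 'n chain \<Rightarrow> _)" using that(2) M(2) by auto
      then show ?thesis using F F' 3(2) M(1) by metis
    next
      case 4
      then have "k \<in> {1..j}" "chain_matrix k = (chain_B k :: 'n chain \<Rightarrow> _)" using that(2) M(2) by auto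
      then show ?thesis using F F' 4(2) by metis
    next
      case 5
      then have "l \<in> {1..<j}" "chain_matrix k = (chain_B (l + 1) :: 'n chain \<Rightarrow> _)"
        "chain_matrix l = (chain_B l :: 'n chain \<Rightarrow> _)" using that(2) M(2) by auto
      then show ?thesis using F F' by metis
    next
      case 6
      then have "k \<in> {1..j}" "l \<in> {1..j}" "\<bar>int k - int l\<bar> > 1"
        "chain_matrix k = (chain_B k :: 'n chain \<Rightarrow> _)" "chain_matrix l = (chain_B l :: 'n chain \<Rightarrow> _)"
        using that(2) M(2) by auto
      then show ?thesis using F F' by metis
    qed
  qed
  have nth: "br (\<lambda>y\<in>chain_space j. chain_matrix k y $ a $ a') (\<lambda>y\<in>chain_space j. chain_matrix l y $ b $ b') x
    = br' (\<lambda>y\<in>chain_space j. chain_matrix k y $ a $ a') (\<lambda>y\<in>chain_space j. chain_matrix l y $ b $ b') x"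
    if "l \<le> k" "k \<le> j" for k l a a' b b'
    using arg_cong[OF eq[OF that], of "\<lambda>T. T $ (a, b) $ (a', b')"] by (simp add: tensor_bracket_def)
  show ?thesis
  proof (cases "l \<le> k")
    case True
    then show ?thesis using nth le by blast
  next
    case False
    then show ?thesis
      using nth[of k l b b' a a'] le
      unfolding poisson_structure_skew[OF P chain_matrix_in[OF le(1)] chain_matrix_in[OF le(2)] x, of a a']
        poisson_structure_skew[OF P' chain_matrix_in[OF le(1)] chain_matrix_in[OF le(2)] x, of a a']
      by simp
  qed
qed

text \<open>Uniqueness is the statement that the identity is a Poisson map between the two
  structures. Since both brackets lie in the function algebra, agreement on chains makes them equal
  as functions.\<close>

lemma chain_formulas_unique:
  fixes br :: "'n::{finite,linorder} chain bracket"
  assumes P: "poisson_structure (chain_space j) (chain_functions j) br" and formulas: "chain_formulas j Q br"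
    and P': "poisson_structure (chain_space j) (chain_functions j) br'" and formulas': "chain_formulas j Q br'"
    and f: "f \<in> chain_functions j" and g: "g \<in> chain_functions j"
  shows "br f g = br' f g"
proof -
  have ext: "restrict h (chain_space j) = h" if "h \<in> chain_functions j" for h :: "'n chain \<Rightarrow> complex"
    using that unfolding chain_functions_def by (rule restrict_in_function_algebra)
  have "poisson_map (chain_space j) (chain_functions j) br (chain_space j) (chain_functions j) br' (\<lambda>x. x)"
    unfolding chain_functions_eq
  proof (rule poisson_mapI, unfold chain_functions_eq[symmetric])
    fix e e' :: "'n chain \<Rightarrow> complex" and x :: "'n chain"
    assume "e \<in> chain_coord ` chain_indices j" "e' \<in> chain_coord ` chain_indices j"
      and x: "x \<in> chain_space j"
    then show "br (restrict e (chain_space j)) (restrict e' (chain_space j)) x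
        = br' (restrict e (chain_space j)) (restrict e' (chain_space j)) x"
      using chain_formulas_coord[OF P formulas P' formulas' x]
      by (auto simp: chain_indices_def chain_coord_def)
  next
    show "(\<lambda>x\<in>chain_space j. f x) \<in> chain_functions j" if "f \<in> chain_functions j"
      for f :: "'n chain \<Rightarrow> complex"
      using that ext[OF that] by simp
  qed (rule P P' Pi_I chain_inverse_dets_inverse; assumption)+
  then have "br f g x = br' f g x" if "x \<in> chain_space j" for x
    using that f g ext unfolding poisson_map_def by simp
  then have "restrict (br f g) (chain_space j) = restrict (br' f g) (chain_space j)"
    by (intro restrict_ext)
  then show ?thesis
    using ext poisson_structure_closed[OF P f g] poisson_structure_closed[OF P' f g] by simp
qed

theorem lemma4p1:
  fixes j :: nat and Q :: "nat \<Rightarrow> 'n::{finite,linorder} tensor"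
  assumes "j \<ge> 1"
    and "\<forall>k\<in>{0..j - 1}. Q k \<in> Q_types"
  shows "\<exists>br :: 'n chain bracket.
     poisson_structure (chain_space j) (chain_functions j) br \<and>
     chain_formulas j Q br \<and>
     compatible_with_multiple_product j Q br \<and>
     (\<forall>br'. poisson_structure (chain_space j) (chain_functions j) br' \<and> chain_formulas j Q br' \<longrightarrow>
        (\<forall>f\<in>chain_functions j. \<forall>g\<in>chain_functions j. br' f g = br f g))"
proof -
  have Q: "Q k \<in> Q_types" if "k < j" for k using assms that by auto
  note P = chain_bracket_poisson[of j Q] and formulas = chain_bracket_formulas[OF Q assms(1)]
  show ?thesis
  proof (intro exI[of _ "chain_bracket j Q"] conjI allI impI ballI)
    fix br' :: "'n chain bracket" and f g :: "'n chain \<Rightarrow> complex"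
    assume "poisson_structure (chain_space j) (chain_functions j) br' \<and> chain_formulas j Q br'"
      and "f \<in> chain_functions j" "g \<in> chain_functions j"
    then show "br' f g = chain_bracket j Q f g"
      using chain_formulas_unique[OF _ _ P formulas] by blast
  qed (rule P formulas chain_bracket_compatible[OF assms(1) Q]; assumption)+
qed

end
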